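(* Let $d\ge 2$, let $C\in\mathcal{C}_{ar}^d$ be a $d$-dimensional Archimedean copula and let $\gamma\in\mathcal{P}_{\mathcal{W}_d}$ be its corresponding Williamson measure, with Lebesgue decomposition $\gamma=\gamma^{abs}+\gamma^{dis}+\gamma^{sing}$. Then the following three equivalences hold: (i) $\gamma^{dis}([0,\infty))>0$ if and only if $\mu_C^{dis}(\mathbb{I}^d)>0$. (ii) $\gamma^{abs}([0,\infty))>0$ if and only if $\mu_C^{abs}(\mathbb{I}^d)>0$. (iii) $\gamma^{sing}([0,\infty))>0$ if and only if $\mu_C^{sing}(\mathbb{I}^d)>0$.
   Context: Notation: $\mathbb{I}=[0,1]$; conventions $\inf\emptyset=\infty$, $1/\infty=0$, $1/0=\infty$. Archimedean copulas and Williamson measures. A generator is a continuous non-increasing $\psi:[0,\infty)\to\mathbb{I}$ with $\psi(0)=1$, $\psi(\infty):=\lim_{z\to\infty}\psi(z)=0$, strictly decreasing on $[0,\inf\{x:\psi(x)=0\})$; its pseudo-inverse is $\varphi(y)=\inf\{z\in[0,\infty]:\psi(z)=y\}$, $y\in\mathbb{I}$. All generators are normalized by $\psi(1)=\frac12$. A $d$-dimensional Archimedean copula is a copula of the form $C(\mathbf{x})=\psi(\sum_{i=1}^d\varphi(x_i))$; this function is a copula iff $\psi$ is $d$-monotone, i.e. (with $\psi$ continuous on $[0,\infty)$) on $(0,\infty)$ $\psi$ is differentiable up to order $d-2$, $(-1)^k\psi^{(k)}\ge0$ for $k\le d-2$, and $(-1)^{d-2}\psi^{(d-2)}$ is non-increasing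 and convex. $\mathcal{C}_{ar}^d$ is the set of all $d$-dimensional Archimedean copulas. $\mathcal{P}_{\mathcal{W}_d}$ is the set of Borel probability measures $\gamma$ on $[0,\infty)$ with $\gamma(\{0\})=0$ and $\int_{[0,1]}(1-t)^{d-1}d\gamma(t)=\frac12$. The map $\gamma\mapsto\psi$, $\psi(z)=\int_{[0,\infty)}(1-tz)_+^{d-1}d\gamma(t)$, is a bijection from $\mathcal{P}_{\mathcal{W}_d}$ onto the normalized $d$-monotone generators, and $\psi\mapsto C$ is a bijection onto $\mathcal{C}_{ar}^d$; the $\gamma$ associated in this way with $C$ is its Williamson measure. Decompositions. A finite measure is called discrete if it is concentrated on a countable set, and singular if it has no point masses and is concentrated on a Lebesgue null set. $\gamma^{abs},\gamma^{dis},\gamma^{sing}$ are the absolutely continuous (w.r.t. Lebesgue measure), discrete and singular parts of $\gamma$. $\mu_C$ is the probability measure on $\mathbb{I}^d$ with distribution function $C$; $C^{1:d-1}$ is the marginal copula of the first $d-1$ coordinates, with measure $\mu_{C^{1:d-1}}$ (always absolutely continuous for $C\in\mathcal{C}_{ar}^d$). Let $K_C:\mathbb{I}^{d-1}\times\mathcal{B}(\mathbb{I})\to\mathbb{I}$ be (a version of) the regular conditional distribution of the last coordinate given the first $d-1$ under $\mu_C$, and for each $\mathbf{x}$ let $K_C(\mathbf{x},\cdot)=K_C^{abs}(\mathbf{x},\cdot)+K_C^{dis}(\mathbf{x},\cdot)+K_C^{sing}(\mathbf{x},\cdot)$ be its decomposition into absolutely continuous, discrete and singular (i.e. having no point masses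 and concentrated on a Lebesgue null set) parts; these are sub-Markov kernels. For $\ast\in\{abs,dis,sing\}$ the measure $\mu_C^{\ast}$ on $\mathbb{I}^d$ is defined by $\mu_C^{\ast}(E\times F)=\int_E K_C^{\ast}(\mathbf{x},F)\,d\mu_{C^{1:d-1}}(\mathbf{x})$ for Borel $E\subseteq\mathbb{I}^{d-1}$, $F\subseteq\mathbb{I}$. *)

theory Defs
  imports "HOL-Probability.Probability"
begin

text \<open>The extended half-line \<open>[0,\<infinity>]\<close> is the type \<^typ>\<open>ennreal\<close>; in particular the infimum of the
  empty set is \<open>\<infinity>\<close> there. Generators are functions on \<^typ>\<open>real\<close> of which only the values on
  \<open>[0,\<infinity>)\<close> matter.\<close>

definition normalized_generator :: "(real \<Rightarrow> real) \<Rightarrow> bool" where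
  "normalized_generator \<psi> \<longleftrightarrow>
     \<psi> ` {0..} \<subseteq> {0..1} \<and> continuous_on {0..} \<psi> \<and> antimono_on {0..} \<psi> \<and>
     \<psi> 0 = 1 \<and> (\<psi> \<longlongrightarrow> 0) at_top \<and>
     strict_antimono_on {z. 0 \<le> z \<and> ennreal z < Inf (ennreal ` {x. 0 \<le> x \<and> \<psi> x = 0})} \<psi> \<and>
     \<psi> 1 = 1 / 2"

definition generator_ext :: "(real \<Rightarrow> real) \<Rightarrow> ennreal \<Rightarrow> real" where
  "generator_ext \<psi> z = (if z = \<infinity> then 0 else \<psi> (enn2real z))"

definition pseudo_inverse :: "(real \<Rightarrow> real) \<Rightarrow> real \<Rightarrow> ennreal" where
  "pseudo_inverse \<psi> y = Inf {z. generator_ext \<psi> z = y}"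

definition archimedean :: "nat \<Rightarrow> (real \<Rightarrow> real) \<Rightarrow> (nat \<Rightarrow> real) \<Rightarrow> real" where
  "archimedean d \<psi> x = generator_ext \<psi> (\<Sum>i<d. pseudo_inverse \<psi> (x i))"

definition unit_interval :: "real measure" where
  "unit_interval = restrict_space borel {0..1}"

text \<open>The cube \<open>[0,1]\<^sup>d\<close> with its Borel sets; the coordinates are numbered \<open>0, \<dots>, d - 1\<close>.\<close>

definition cube :: "nat \<Rightarrow> (nat \<Rightarrow> real) measure" where
  "cube d = (\<Pi>\<^sub>M i\<in>{..<d}. unit_interval)"

text \<open>\<open>\<mu>\<close> is the probability measure \<open>\<mu>\<^sub>C\<close> on \<open>[0,1]\<^sup>d\<close> with distribution function \<open>C\<close>. Only the values
  of \<open>C\<close> on the cube matter.\<close>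

definition has_distribution_function ::
    "nat \<Rightarrow> ((nat \<Rightarrow> real) \<Rightarrow> real) \<Rightarrow> (nat \<Rightarrow> real) measure \<Rightarrow> bool" where
  "has_distribution_function d C \<mu> \<longleftrightarrow>
     prob_space \<mu> \<and> sets \<mu> = sets (cube d) \<and>
     (\<forall>x\<in>space (cube d). measure \<mu> {y \<in> space (cube d). \<forall>i<d. y i \<le> x i} = C x)"

definition copula :: "nat \<Rightarrow> ((nat \<Rightarrow> real) \<Rightarrow> real) \<Rightarrow> bool" where
  "copula d C \<longleftrightarrow>
     (\<exists>\<mu>. has_distribution_function d C \<mu> \<and>
        (\<forall>i<d. distr \<mu> borel (\<lambda>x. x i) = uniform_measure lborel {0..1}))"

definition archimedean_copulas :: "nat \<Rightarrow> ((nat \<Rightarrow> real) \<Rightarrow> real) set" where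
  "archimedean_copulas d =
     {C. copula d C \<and>
         (\<exists>\<psi>. normalized_generator \<psi> \<and> (\<forall>x\<in>space (cube d). C x = archimedean d \<psi> x))}"

definition williamson_probs :: "nat \<Rightarrow> real measure set" where
  "williamson_probs d =
     {\<gamma>. prob_space \<gamma> \<and> sets \<gamma> = sets (restrict_space borel {0::real..}) \<and>
         emeasure \<gamma> {0} = 0 \<and> (LINT t:{0..1}|\<gamma>. (1 - t) ^ (d - 1)) = 1 / 2}"

definition williamson_transform :: "nat \<Rightarrow> real measure \<Rightarrow> real \<Rightarrow> real" where
  "williamson_transform d \<gamma> z = (LINT t|\<gamma>. max 0 (1 - t * z) ^ (d - 1))"

definition williamson_measure_of ::
    "nat \<Rightarrow> ((nat \<Rightarrow> real) \<Rightarrow> real) \<Rightarrow> real measure \<Rightarrow> bool" where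
  "williamson_measure_of d C \<gamma> \<longleftrightarrow>
     \<gamma> \<in> williamson_probs d \<and>
     (\<exists>\<psi>. normalized_generator \<psi> \<and> (\<forall>z\<ge>0. \<psi> z = williamson_transform d \<gamma> z) \<and>
          (\<forall>x\<in>space (cube d). C x = archimedean d \<psi> x))"

definition discrete_measure :: "real measure \<Rightarrow> bool" where
  "discrete_measure M \<longleftrightarrow>
     finite_measure M \<and> (\<exists>N. countable N \<and> N \<subseteq> space M \<and> emeasure M (space M - N) = 0)"

definition singular_measure :: "real measure \<Rightarrow> bool" where
  "singular_measure M \<longleftrightarrow>
     finite_measure M \<and> (\<forall>x\<in>space M. emeasure M {x} = 0) \<and>
     (\<exists>N\<in>sets M. emeasure lborel N = 0 \<and> emeasure M (space M - N) = 0)"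

text \<open>\<open>M\<close> is a Borel measure on a Borel subset \<^term>\<open>space M\<close> of the real line.\<close>

definition lebesgue_decomposition ::
    "real measure \<Rightarrow> real measure \<Rightarrow> real measure \<Rightarrow> real measure \<Rightarrow> bool" where
  "lebesgue_decomposition M Mabs Mdis Msing \<longleftrightarrow>
     sets Mabs = sets M \<and> sets Mdis = sets M \<and> sets Msing = sets M \<and>
     (\<forall>X\<in>sets M. emeasure M X = emeasure Mabs X + emeasure Mdis X + emeasure Msing X) \<and>
     absolutely_continuous (restrict_space lborel (space M)) Mabs \<and>
     discrete_measure Mdis \<and> singular_measure Msing"

definition initial_marginal :: "nat \<Rightarrow> (nat \<Rightarrow> real) measure \<Rightarrow> (nat \<Rightarrow> real) measure" where
  "initial_marginal d \<mu> = distr \<mu> (cube (d - 1)) (\<lambda>x. restrict x {..<d - 1})"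

text \<open>The product set \<open>E \<times> F\<close> with \<open>E \<subseteq> [0,1]\<^sup>d\<^sup>-\<^sup>1\<close> and \<open>F \<subseteq> [0,1]\<close>, as a subset of \<open>[0,1]\<^sup>d\<close>.\<close>

definition cylinder :: "nat \<Rightarrow> (nat \<Rightarrow> real) set \<Rightarrow> real set \<Rightarrow> (nat \<Rightarrow> real) set" where
  "cylinder d E F = {x \<in> space (cube d). restrict x {..<d - 1} \<in> E \<and> x (d - 1) \<in> F}"

definition kernel_product ::
    "nat \<Rightarrow> (nat \<Rightarrow> real) measure \<Rightarrow> ((nat \<Rightarrow> real) \<Rightarrow> real measure) \<Rightarrow>
     (nat \<Rightarrow> real) measure \<Rightarrow> bool" where
  "kernel_product d \<nu> \<kappa> \<mu> \<longleftrightarrow>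
     sets \<mu> = sets (cube d) \<and>
     (\<forall>E\<in>sets (cube (d - 1)). \<forall>F\<in>sets unit_interval.
        emeasure \<mu> (cylinder d E F) = (\<integral>\<^sup>+x\<in>E. emeasure (\<kappa> x) F \<partial>\<nu>))"

definition conditional_distribution ::
    "nat \<Rightarrow> (nat \<Rightarrow> real) measure \<Rightarrow> ((nat \<Rightarrow> real) \<Rightarrow> real measure) \<Rightarrow> bool" where
  "conditional_distribution d \<mu> K \<longleftrightarrow>
     K \<in> cube (d - 1) \<rightarrow>\<^sub>M prob_algebra unit_interval \<and>
     kernel_product d (initial_marginal d \<mu>) K \<mu>"

text \<open>The initial marginal of \<open>\<mu>\<^sub>C\<close> is the measure of the marginal copula
  \<open>(x\<^sub>0, \<dots>, x\<^sub>d\<^sub>-\<^sub>2) \<mapsto> C (x\<^sub>0, \<dots>, x\<^sub>d\<^sub>-\<^sub>2, 1)\<close>.\<close>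

lemma space_cube: "space (cube d) = {..<d} \<rightarrow>\<^sub>E {0..1}"
  by (simp add: cube_def space_PiM unit_interval_def space_restrict_space)

lemma has_distribution_function_initial_marginal:
  assumes "2 \<le> d" and "has_distribution_function d C \<mu>"
  shows "has_distribution_function (d - 1) (\<lambda>x. C (x(d - 1 := 1))) (initial_marginal d \<mu>)"
proof -
  let ?r = "\<lambda>x::nat \<Rightarrow> real. restrict x {..<d - 1}"
  have s: "sets \<mu> = sets (cube d)" and p: "prob_space \<mu>"
    and c: "\<And>x. x \<in> space (cube d) \<Longrightarrow>
        measure \<mu> {y \<in> space (cube d). \<forall>i<d. y i \<le> x i} = C x"
    using assms(2) by (auto simp: has_distribution_function_def)
  have sp: "space \<mu> = space (cube d)" using s by (rule sets_eq_imp_space_eq)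
  have "?r \<in> cube d \<rightarrow>\<^sub>M cube (d - 1)"
    unfolding cube_def by (rule measurable_restrict_subset) auto
  hence r: "?r \<in> \<mu> \<rightarrow>\<^sub>M cube (d - 1)" by (simp add: measurable_cong_sets[OF s refl])
  have "measure (distr \<mu> (cube (d - 1)) ?r) {y \<in> space (cube (d - 1)). \<forall>i<d - 1. y i \<le> x i}
      = C (x(d - 1 := 1))" if x: "x \<in> space (cube (d - 1))" for x
  proof -
    let ?A = "{y \<in> space (cube (d - 1)). \<forall>i<d - 1. y i \<le> x i}"
    have "{y \<in> space (cube (d - 1)). y i \<le> x i} \<in> sets (cube (d - 1))" if "i < d - 1" for i
    proof -
      have "(\<lambda>y. y i) \<in> cube (d - 1) \<rightarrow>\<^sub>M unit_interval"
        using that unfolding cube_def by (intro measurable_component_singleton) auto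
      hence "(\<lambda>y. y i) \<in> borel_measurable (cube (d - 1))"
        unfolding unit_interval_def by (simp add: measurable_restrict_space2_iff)
      thus ?thesis by measurable
    qed
    hence "(\<Inter>i\<in>{..<d - 1}. {y \<in> space (cube (d - 1)). y i \<le> x i}) \<in> sets (cube (d - 1))"
      using assms(1) by (intro sets.finite_INT) (auto simp: lessThan_empty_iff)
    also have "(\<Inter>i\<in>{..<d - 1}. {y \<in> space (cube (d - 1)). y i \<le> x i}) = ?A"
    proof -
      have "0 \<in> {..<d - 1}" using assms(1) by simp
      thus ?thesis by blast
    qed
    finally have A: "?A \<in> sets (cube (d - 1))" .
    have e: "?r -` ?A \<inter> space \<mu> = {y \<in> space (cube d). \<forall>i<d. y i \<le> (x(d - 1 := 1)) i}"
    proof (intro set_eqI)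
      fix y
      have lt: "i < d \<longleftrightarrow> i < d - 1 \<or> i = d - 1" for i using assms(1) by auto
      have "?r y \<in> space (cube (d - 1))" if "y \<in> space (cube d)"
        using that unfolding space_cube by (auto simp: PiE_iff)
      moreover have "y (d - 1) \<le> 1" if "y \<in> space (cube d)"
        using that assms(1) unfolding space_cube by (auto simp: PiE_iff)
      ultimately show "y \<in> ?r -` ?A \<inter> space \<mu> \<longleftrightarrow>
          y \<in> {y \<in> space (cube d). \<forall>i<d. y i \<le> (x(d - 1 := 1)) i}"
        unfolding sp lt by auto
    qed
    have "x(d - 1 := 1) \<in> space (cube d)"
      using x assms(1) unfolding space_cube by (auto simp: PiE_iff extensional_def)
    from c[OF this] show ?thesis unfolding measure_distr[OF r A] e .
  qed
  thus ?thesis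
    using prob_space.prob_space_distr[OF p r]
    by (simp add: has_distribution_function_def initial_marginal_def)
qed

end

theory Submission
  imports Defs
begin

text \<open>Write \<open>d = n + 1\<close>. If \<open>T\<close> has law \<open>\<gamma>\<close> and \<open>X\<close> is uniform on the simplex
  \<open>{x \<ge> 0. x\<^sub>0 + \<dots> + x\<^sub>n = 1 / T}\<close>, then \<open>(\<psi> X\<^sub>0, \<dots>, \<psi> X\<^sub>n)\<close> has law \<open>\<mu>\<^sub>C\<close>: the volume of a corner of the
  simplex is \<open>(1 - t z)\<^sub>+\<^sup>n\<close>, whose \<open>\<gamma>\<close>-integral is \<open>\<psi> z\<close>. The first \<open>n\<close> coordinates of \<open>X\<close> together with
  \<open>T\<close> have an explicit density \<open>f\<close> with respect to Lebesgue measure times \<open>\<gamma>\<close>, so the conditional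
  distribution at \<open>(\<psi> x\<^sub>0, \<dots>, \<psi> x\<^sub>n\<^sub>-\<^sub>1)\<close> is the normalized image of \<open>f x t d\<gamma>(t)\<close> under
  \<open>t \<mapsto> \<psi> (1 / t - x\<^sub>0 - \<dots> - x\<^sub>n\<^sub>-\<^sub>1)\<close>. Since \<open>\<psi>\<close> is convex and strictly decreasing where it is positive, this
  map is injective and preserves Lebesgue null sets in both directions, so it carries the
  absolutely continuous, discrete and singular parts of \<open>\<gamma>\<close> to those of the conditional distribution.
  Integrating \<open>f\<close> over \<open>x\<close> first gives the stronger fact that the corresponding parts of \<open>\<gamma>\<close> and \<open>\<mu>\<^sub>C\<close>
  have the same total mass.\<close>

subsection \<open>Convex generators and Lebesgue null sets\<close>

text \<open>Induction on \<open>n\<close>: multiplying the bound for \<open>n\<close> by the convex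
  combination gives the bound for \<open>Suc n\<close> minus
  \<open>u * (1 - u) * ((a - b) * (a ^ n - b ^ n))\<close>, and this defect is non-negative because
  both differences have the same sign.\<close>

lemma power_convex_combination_le:
  fixes a b u :: real
  assumes "0 \<le> a" "0 \<le> b" "0 \<le> u" "u \<le> 1"
  shows "((1 - u) * a + u * b) ^ n \<le> (1 - u) * a ^ n + u * b ^ n"
proof (induction n)
  case (Suc n)
  have "0 \<le> (a - b) * (a ^ n - b ^ n)"
  proof (cases "a \<le> b")
    case True
    then have "a ^ n \<le> b ^ n" using assms by (intro power_mono) auto
    with True show ?thesis by (simp add: mult_nonpos_nonpos)
  next
    case False
    then have "b ^ n \<le> a ^ n" using assms by (intro power_mono) auto
    with False show ?thesis by simp
  qed
  then have *: "0 \<le> u * (1 - u) * ((a - b) * (a ^ n - b ^ n))"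
    using assms by simp
  have "((1 - u) * a + u * b) ^ Suc n \<le> ((1 - u) * a + u * b) * ((1 - u) * a ^ n + u * b ^ n)"
    using Suc assms by (simp add: mult_left_mono)
  also have "\<dots> = (1 - u) * a ^ Suc n + u * b ^ Suc n - u * (1 - u) * ((a - b) * (a ^ n - b ^ n))"
    by (simp add: algebra_simps)
  also have "\<dots> \<le> (1 - u) * a ^ Suc n + u * b ^ Suc n"
    using * by simp
  finally show ?case .
qed simp

text \<open>The positive part of an affine function is convex, and the power is increasing and
  convex on non-negative numbers. Integrating over \<open>t\<close> will give the convexity of
  \<psi>.\<close>

lemma truncated_power_convex_combination_le:
  fixes t x y u :: real
  assumes "0 \<le> u" "u \<le> 1"
  shows "max 0 (1 - t * ((1 - u) * x + u * y)) ^ n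
    \<le> (1 - u) * max 0 (1 - t * x) ^ n + u * max 0 (1 - t * y) ^ n"
proof -
  have "(1 - u) * (1 - t * x) \<le> (1 - u) * max 0 (1 - t * x)" "u * (1 - t * y) \<le> u * max 0 (1 - t * y)"
    using assms by (auto intro!: mult_left_mono)
  moreover have "1 - t * ((1 - u) * x + u * y) = (1 - u) * (1 - t * x) + u * (1 - t * y)"
    by (simp add: algebra_simps)
  moreover have "0 \<le> (1 - u) * max 0 (1 - t * x) + u * max 0 (1 - t * y)"
    using assms by simp
  ultimately have "max 0 (1 - t * ((1 - u) * x + u * y)) \<le> (1 - u) * max 0 (1 - t * x) + u * max 0 (1 - t * y)"
    by simp
  then have "max 0 (1 - t * ((1 - u) * x + u * y)) ^ n \<le> ((1 - u) * max 0 (1 - t * x) + u * max 0 (1 - t * y)) ^ n"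
    by (rule power_mono) simp
  also have "\<dots> \<le> (1 - u) * max 0 (1 - t * x) ^ n + u * max 0 (1 - t * y) ^ n"
    by (rule power_convex_combination_le) (use assms in auto)
  finally show ?thesis .
qed

text \<open>Both adjacent slopes are compared with the slope of the chord from \<open>x\<close> to
  \<open>z\<close>.\<close>

lemma convex_on_slope_mono:
  fixes f :: "real \<Rightarrow> real"
  assumes "convex_on I f" "x \<in> I" "y \<in> I" "z \<in> I" "x < y" "y < z"
  shows "(f y - f x) / (y - x) \<le> (f z - f y) / (z - y)"
proof -
  have "(f x - f y) / (x - y) \<le> (f x - f z) / (x - z)" "(f x - f z) / (x - z) \<le> (f y - f z) / (y - z)"
    using convex_on_slope_le[OF assms(1,2,4,5,6)] by auto
  then have "(f x - f y) / (x - y) \<le> (f y - f z) / (y - z)" by (rule order_trans)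
  moreover have "(f x - f y) / (x - y) = (f y - f x) / (y - x)"
    by (simp only: minus_divide_divide[of "f x - f y" "x - y", symmetric] minus_diff_eq)
  moreover have "(f y - f z) / (y - z) = (f z - f y) / (z - y)"
    by (simp only: minus_divide_divide[of "f y - f z" "y - z", symmetric] minus_diff_eq)
  ultimately show ?thesis by simp
qed

text \<open>Such a function is locally Lipschitz on the open half-line: to the right of
  \<open>x / 2\<close> no chord is steeper than the one from \<open>0\<close> to
  \<open>x / 2\<close>, whose descent is \<open>B\<close>. The point \<open>0\<close> is excluded
  because the slope may be infinite there.\<close>

lemma negligible_convex_antimono_image:
  fixes \<psi> :: "real \<Rightarrow> real"
  assumes cvx: "convex_on {0..} \<psi>" and anti: "antimono_on {0..} \<psi>"
    and N: "negligible N" "N \<subseteq> {0<..}"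
  shows "negligible (\<psi> ` N)"
proof (rule negligible_locally_Lipschitz_image[OF _ N(1)])
  fix x assume "x \<in> N"
  then have x: "0 < x" using N by auto
  define B where "B = (\<psi> 0 - \<psi> (x / 2)) / (x / 2)"
  have mono: "\<psi> b \<le> \<psi> a" if "0 \<le> a" "a \<le> b" for a b
    using anti that by (auto simp: monotone_on_def)
  have key: "\<psi> a - \<psi> b \<le> B * (b - a)" if "x / 2 < a" "a < b" for a b
  proof -
    have "(\<psi> (x / 2) - \<psi> 0) / (x / 2 - 0) \<le> (\<psi> a - \<psi> (x/2)) / (a - x/2)"
      by (rule convex_on_slope_mono[OF cvx]) (use that x in auto)
    also have "\<dots> \<le> (\<psi> b - \<psi> a) / (b - a)"
      by (rule convex_on_slope_mono[OF cvx]) (use that x in auto)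
    also have "(\<psi> (x / 2) - \<psi> 0) / (x / 2 - 0) = - B"
      unfolding B_def by (metis diff_zero minus_diff_eq minus_divide_left)
    finally have "- B \<le> (\<psi> b - \<psi> a) / (b - a)" .
    then have "- B * (b - a) \<le> \<psi> b - \<psi> a" using that by (simp add: pos_le_divide_eq)
    then show ?thesis by simp
  qed
  have "norm (\<psi> y - \<psi> x) \<le> B * norm (y - x)" if "x / 2 < y" for y
  proof (cases y x rule: linorder_cases)
    case less
    then show ?thesis using key[of y x] mono[of y x] that x by auto
  next
    case greater
    then show ?thesis using key[of x y] mono[of x y] that x by auto
  qed simp
  then show "\<exists>T B. open T \<and> x \<in> T \<and> (\<forall>y\<in>N \<inter> T. norm (\<psi> y - \<psi> x) \<le> B * norm (y - x))"
    using x by (intro exI[of _ "{x/2<..}"] exI[of _ B]) auto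
qed simp

text \<open>Where \<psi> is positive it is injective with a locally Lipschitz inverse: by convexity,
  chords with one end at \<open>x\<close> and the other to the left of some \<open>w > x\<close> are
  at least as steep as the chord from \<open>x\<close> to \<open>w\<close>, which is not flat. The
  set is thus a Lipschitz image of a subset of \<open>N\<close>.\<close>

lemma negligible_convex_antimono_vimage:
  fixes \<psi> :: "real \<Rightarrow> real"
  assumes cvx: "convex_on {0..} \<psi>" and anti: "antimono_on {0..} \<psi>"
    and strict: "\<And>a b. 0 \<le> a \<Longrightarrow> a < b \<Longrightarrow> 0 < \<psi> a \<Longrightarrow> \<psi> b < \<psi> a"
    and N: "negligible N"
  shows "negligible {z. 0 \<le> z \<and> 0 < \<psi> z \<and> \<psi> z \<in> N}"
proof -
  define S where "S = {z. 0 \<le> z \<and> 0 < \<psi> z \<and> \<psi> z \<in> N}"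
  have inj: "inj_on \<psi> S"
  proof (rule linorder_inj_onI)
    fix x y assume "x < y" "x \<in> S" "y \<in> S"
    then show "\<psi> x \<noteq> \<psi> y" using strict[of x y] by (auto simp: S_def)
  qed auto
  have "negligible (the_inv_into S \<psi> ` (\<psi> ` S))"
  proof (rule negligible_locally_Lipschitz_image)
    show "negligible (\<psi> ` S)"
      by (rule negligible_subset[OF N]) (auto simp: S_def)
    fix v assume "v \<in> \<psi> ` S"
    then obtain x where x: "x \<in> S" "v = \<psi> x" by auto
    \<comment> \<open>At distance 1 the slope of the chord is just
      \<open>\<psi> w - \<psi> x\<close>. The neighbourhood \<open>{\<psi> w<..}\<close> of
      \<open>v\<close> contains only values taken to the left of \<open>w\<close>.\<close>
    define w where "w = x + 1"
    have xw: "0 \<le> x" "x < w" "\<psi> w < \<psi> x"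
      using x strict[of x w] by (auto simp: S_def w_def)
    have *: "norm (y - x) \<le> 1 / (\<psi> x - \<psi> w) * norm (\<psi> y - \<psi> x)"
      if y: "y \<in> S" "\<psi> w < \<psi> y" for y
    proof -
      have y0: "0 \<le> y" "0 < \<psi> y" "0 < \<psi> x" using x y by (auto simp: S_def)
      have yw: "y < w"
      proof (rule ccontr)
        assume "\<not> y < w"
        then have "\<psi> y \<le> \<psi> w" using anti xw by (auto simp: monotone_on_def)
        with y show False by simp
      qed
      show ?thesis
      proof (cases y x rule: linorder_cases)
        case less
        have "(\<psi> x - \<psi> y) / (x - y) \<le> (\<psi> w - \<psi> x) / (w - x)"
          by (rule convex_on_slope_mono[OF cvx]) (use less xw y0 in auto)
        moreover have "w - x = 1" by (simp add: w_def)
        ultimately have "\<psi> x - \<psi> y \<le> (\<psi> w - \<psi> x) * (x - y)"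
          using less by (simp add: pos_divide_le_eq)
        then have "(\<psi> x - \<psi> w) * (x - y) \<le> \<psi> y - \<psi> x"
          by (simp add: algebra_simps)
        then have "x - y \<le> (\<psi> y - \<psi> x) / (\<psi> x - \<psi> w)"
          using xw by (simp add: pos_le_divide_eq mult.commute)
        then show ?thesis using less strict[of y x] y0 xw(1) by simp
      next
        case greater
        have "(\<psi> x - \<psi> y) / (x - y) \<le> (\<psi> x - \<psi> w) / (x - w)"
          by (rule convex_on_slope_le(1)[OF cvx]) (use greater xw y0 yw in auto)
        moreover have "(\<psi> x - \<psi> y) / (x - y) = (\<psi> y - \<psi> x) / (y - x)"
          by (simp only: minus_divide_divide[of "\<psi> x - \<psi> y" "x - y", symmetric] minus_diff_eq)
        moreover have "x - w = - 1" by (simp add: w_def)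
        ultimately have "\<psi> y - \<psi> x \<le> (\<psi> w - \<psi> x) * (y - x)"
          using greater by (simp add: pos_divide_le_eq)
        then have "(\<psi> x - \<psi> w) * (y - x) \<le> \<psi> x - \<psi> y"
          by (simp add: algebra_simps)
        then have "y - x \<le> (\<psi> x - \<psi> y) / (\<psi> x - \<psi> w)"
          using xw by (simp add: pos_le_divide_eq mult.commute)
        then show ?thesis using greater strict[of x y] y0 xw(1) by simp
      qed simp
    qed
    show "\<exists>T B. open T \<and> v \<in> T \<and> (\<forall>y\<in>\<psi> ` S \<inter> T.
        norm (the_inv_into S \<psi> y - the_inv_into S \<psi> v) \<le> B * norm (y - v))"
      using xw x *
      by (intro exI[of _ "{\<psi> w<..}"] exI[of _ "1 / (\<psi> x - \<psi> w)"])
        (auto simp: the_inv_into_f_f[OF inj])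
  qed simp
  also have "the_inv_into S \<psi> ` (\<psi> ` S) = S"
    using the_inv_into_f_f[OF inj] by force
  finally show ?thesis unfolding S_def .
qed

subsection \<open>The volume of a corner simplex\<close>

lemma nn_integral_power_Icc:
  fixes a B :: real
  assumes "a \<le> B"
  shows "(\<integral>\<^sup>+y. indicator {a..B} y * ennreal ((B - y) ^ n / fact n) \<partial>lborel)
    = ennreal ((B - a) ^ Suc n / fact (Suc n))"
proof -
  have "(\<integral>\<^sup>+y. ennreal ((B - y) ^ n / fact n) * indicator {a..B} y \<partial>lborel)
    = ennreal (- ((B - B) ^ Suc n / fact (Suc n)) - (- ((B - a) ^ Suc n / fact (Suc n))))"
  proof (rule nn_integral_FTC_Icc[where F="\<lambda>y. - ((B - y) ^ Suc n / fact (Suc n))"])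
    fix x assume "x \<in> {a..B}"
    have "((\<lambda>y. (B - y) ^ Suc n) has_real_derivative real (Suc n) * (0 - 1) * (B - x) ^ n) (at x)"
      by (rule DERIV_cong, (rule derivative_intros)+) (simp add: algebra_simps)
    from DERIV_minus[OF DERIV_cdivide[OF this, of "fact (Suc n)"]]
    show "((\<lambda>y. - ((B - y) ^ Suc n / fact (Suc n))) has_real_derivative (B - x) ^ n / fact n) (at x)"
      by (rule DERIV_cong) (simp add: divide_simps del: of_nat_Suc)
  qed (use assms in auto)
  then show ?thesis by (simp add: mult.commute)
qed

interpretation lborel_product: product_sigma_finite "\<lambda>_::nat. lborel :: real measure"
  by (rule product_sigma_finite.intro) (rule lborel.sigma_finite_measure_axioms)

lemma sets_corner_simplex [measurable]:
  "Measurable.pred (\<Pi>\<^sub>M i\<in>{..<n::nat}. lborel) (\<lambda>x. (\<forall>i<n. (a::nat \<Rightarrow> real) i \<le> x i) \<and> (\<Sum>i<n. x i) \<le> c)"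
proof -
  have "Measurable.pred (\<Pi>\<^sub>M i\<in>{..<n::nat}. lborel) (\<lambda>x. (\<forall>i\<in>{..<n}. a i \<le> x i) \<and> (\<Sum>i<n. x i) \<le> c)"
    by measurable
  then show ?thesis by (simp add: Ball_def)
qed

text \<open>Slicing along the last coordinate \<open>y\<close> leaves a corner simplex of one
  dimension less with bound \<open>c - y\<close>; integrating its volume over \<open>y\<close>
  raises the exponent by one. The case distinction matters, since for an empty simplex the power on
  its own could be positive.\<close>

lemma nn_integral_corner_simplex:
  fixes a :: "nat \<Rightarrow> real" and c :: real
  shows "(\<integral>\<^sup>+x. indicator {x. (\<forall>i<n. a i \<le> x i) \<and> (\<Sum>i<n. x i) \<le> c} x \<partial>(\<Pi>\<^sub>M i\<in>{..<n}. lborel))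
    = (if (\<Sum>i<n. a i) \<le> c then ennreal ((c - (\<Sum>i<n. a i)) ^ n / fact n) else 0)"
proof (induction n arbitrary: c)
  case 0
  have "{x. (\<forall>i<0. a i \<le> x i) \<and> (\<Sum>i<0. x i) \<le> c} = {x. 0 \<le> c}" by auto
  then show ?case
    unfolding lessThan_0 PiM_empty by (subst nn_integral_count_space_finite) (auto simp: indicator_def)
next
  case (Suc n)
  define s where "s = (\<Sum>i<n. a i)"
  define M where "M k = (\<Pi>\<^sub>M i\<in>{..<k::nat}. lborel :: real measure)" for k
  define Q where "Q k c = {x. (\<forall>i<k. a i \<le> x i) \<and> (\<Sum>i<k. x i) \<le> c}" for k and c :: real
  have [measurable]: "Measurable.pred (M k) (\<lambda>x. x \<in> Q k c)" for k c
    unfolding M_def Q_def mem_Collect_eq by (rule sets_corner_simplex)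
  have indicator_meas: "indicator (Q (Suc n) c) \<in> borel_measurable (M (Suc n))"
    by measurable
  have IH: "(\<integral>\<^sup>+x. indicator (Q n c) x \<partial>M n) = (if s \<le> c then ennreal ((c - s) ^ n / fact n) else 0)" for c
    unfolding M_def Q_def s_def by (rule Suc)
  have "(\<integral>\<^sup>+x. indicator (Q (Suc n) c) x \<partial>M (Suc n))
    = (\<integral>\<^sup>+y. (\<integral>\<^sup>+x. indicator (Q (Suc n) c) (x(n := y)) \<partial>M n) \<partial>lborel)"
    unfolding M_def lessThan_Suc
    by (rule lborel_product.product_nn_integral_insert_rev)
      (simp_all add: indicator_meas[unfolded M_def lessThan_Suc])
  also have "\<dots> = (\<integral>\<^sup>+y. (\<integral>\<^sup>+x. indicator {a n..} y * indicator (Q n (c - y)) x \<partial>M n) \<partial>lborel)"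
    by (intro nn_integral_cong) (auto simp: indicator_def less_Suc_eq Q_def split: if_splits)
  also have "\<dots> = (\<integral>\<^sup>+y. indicator {a n..} y * (if s \<le> c - y then ennreal ((c - y - s) ^ n / fact n) else 0) \<partial>lborel)"
    by (subst nn_integral_cmult) (auto simp: IH)
  also have "\<dots> = (\<integral>\<^sup>+y. indicator {a n..c - s} y * ennreal ((c - s - y) ^ n / fact n) \<partial>lborel)"
    by (intro nn_integral_cong) (auto simp: indicator_def algebra_simps)
  also have "\<dots> = (if s + a n \<le> c then ennreal ((c - (s + a n)) ^ Suc n / fact (Suc n)) else 0)"
  proof (cases "a n \<le> c - s")
    case True
    then show ?thesis by (subst nn_integral_power_Icc) (auto simp: algebra_simps)
  qed auto
  finally show ?case by (simp add: M_def Q_def s_def)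
qed

subsection \<open>Lebesgue decompositions\<close>

text \<open>The identity passes from indicators to simple functions by linearity, and to increasing
  limits because suprema of increasing sequences may be added.\<close>

lemma nn_integral_add_measures:
  assumes sets: "sets A = sets M" "sets B = sets M" "sets C = sets M"
    and add: "\<And>X. X \<in> sets M \<Longrightarrow> emeasure M X = emeasure A X + emeasure B X + emeasure C X"
    and f: "f \<in> borel_measurable M"
  shows "(\<integral>\<^sup>+x. f x \<partial>M) = (\<integral>\<^sup>+x. f x \<partial>A) + (\<integral>\<^sup>+x. f x \<partial>B) + (\<integral>\<^sup>+x. f x \<partial>C)"
  using f
proof (induction rule: borel_measurable_induct)
  case (cong f g)
  have "space A = space M" "space B = space M" "space C = space M"
    using sets by (auto dest: sets_eq_imp_space_eq)
  then have "(\<integral>\<^sup>+x. f x \<partial>N) = (\<integral>\<^sup>+x. g x \<partial>N)" if "N \<in> {M, A, B, C}" for N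
    using that cong by (intro nn_integral_cong) auto
  with cong show ?case by simp
next
  case (set X)
  then show ?case using add sets by simp
next
  case (mult u c)
  have [measurable_cong]: "sets A = sets M" "sets B = sets M" "sets C = sets M" by fact+
  note [measurable] = mult(2)
  show ?case using mult by (simp add: nn_integral_cmult distrib_left)
next
  case (add u v)
  have [measurable_cong]: "sets A = sets M" "sets B = sets M" "sets C = sets M" by fact+
  note [measurable] = add(1,3)
  show ?case using add by (simp add: nn_integral_add ac_simps)
next
  case (seq U)
  have [measurable_cong]: "sets A = sets M" "sets B = sets M" "sets C = sets M" by fact+
  note [measurable] = seq(1)
  have S: "(\<integral>\<^sup>+x. (SUP i. U i x) \<partial>N) = (SUP i. \<integral>\<^sup>+x. U i x \<partial>N)" if "sets N = sets M" for N
    using seq by (intro nn_integral_monotone_convergence_SUP) (auto simp: measurable_cong_sets[OF that refl])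
  have I: "incseq (\<lambda>i. \<integral>\<^sup>+x. U i x \<partial>N)" for N
    using \<open>incseq U\<close> by (auto intro!: nn_integral_mono simp: incseq_def le_fun_def)
  show ?case
    unfolding SUP_apply S[OF refl] S[OF sets(1)] S[OF sets(2)] S[OF sets(3)]
    using seq I by (simp add: ennreal_SUP_add incseq_def add_mono)
qed

text \<open>Let \<open>P\<close> be countable and carry both discrete parts, and let the null set
  \<open>Q\<close> contain \<open>P\<close> and carry both singular parts as well. Only the discrete
  parts charge \<open>P\<close>, and only the discrete and singular parts charge \<open>Q\<close>.
  Evaluating the hypothesis on \<open>P\<close>, \<open>Q\<close> and \<Omega> therefore compares
  the discrete, singular and absolutely continuous masses one after the other.\<close>

lemma lebesgue_decomposition_mass_unique:
  fixes c :: ennreal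
  assumes M: "lebesgue_decomposition M A D S" "finite_measure M"
    and M': "lebesgue_decomposition M' A' D' S'" "finite_measure M'"
    and sets_M: "sets M = sets (restrict_space borel \<Omega>)" "sets M' = sets (restrict_space borel \<Omega>)"
    and \<Omega>: "\<Omega> \<in> sets borel"
    and c: "\<And>X. X \<in> sets M \<Longrightarrow> emeasure M' X = c * emeasure M X"
  shows "emeasure A' \<Omega> = c * emeasure A \<Omega>"
    and "emeasure D' \<Omega> = c * emeasure D \<Omega>"
    and "emeasure S' \<Omega> = c * emeasure S \<Omega>"
proof -
  note dec = M(1)[unfolded lebesgue_decomposition_def] M'(1)[unfolded lebesgue_decomposition_def]
  have in_sets: "X \<in> sets M \<longleftrightarrow> X \<in> sets borel \<and> X \<subseteq> \<Omega>" for X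
    unfolding sets_M using \<Omega> by (subst sets_restrict_space_iff) auto
  have sp: "space M = \<Omega>" "space M' = \<Omega>" 
    using sets_M[THEN sets_eq_imp_space_eq] by (auto simp: space_restrict_space)
  have ac: "absolutely_continuous (restrict_space lborel \<Omega>) A"
    "absolutely_continuous (restrict_space lborel \<Omega>) A'"
    using dec unfolding sp by blast+
  have sets: "sets A = sets M" "sets D = sets M" "sets S = sets M"
    "sets A' = sets M" "sets D' = sets M" "sets S' = sets M" "sets M' = sets M"
    using dec sets_M by auto
  then have spaces: "space A = \<Omega>" "space D = \<Omega>" "space S = \<Omega>"
    "space A' = \<Omega>" "space D' = \<Omega>" "space S' = \<Omega>"
    unfolding sp[symmetric] by (auto dest: sets_eq_imp_space_eq)
  have add: "emeasure M X = emeasure A X + emeasure D X + emeasure S X"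
    "emeasure M' X = emeasure A' X + emeasure D' X + emeasure S' X" if "X \<in> sets M" for X
    using dec that sets by auto
  have dis: "discrete_measure D" "discrete_measure D'" and sing: "singular_measure S" "singular_measure S'"
    using dec by auto
  obtain N1 where N1: "countable N1" "N1 \<subseteq> \<Omega>" "emeasure D (\<Omega> - N1) = 0"
    using dis by (auto simp: discrete_measure_def spaces)
  obtain N2 where N2: "countable N2" "N2 \<subseteq> \<Omega>" "emeasure D' (\<Omega> - N2) = 0"
    using dis by (auto simp: discrete_measure_def spaces)
  obtain N3 where N3: "N3 \<in> sets M" "emeasure lborel N3 = 0" "emeasure S (\<Omega> - N3) = 0"
    using sing by (auto simp: singular_measure_def spaces sets)
  obtain N4 where N4: "N4 \<in> sets M" "emeasure lborel N4 = 0" "emeasure S' (\<Omega> - N4) = 0"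
    using sing by (auto simp: singular_measure_def spaces sets)
  define P where "P = N1 \<union> N2"
  define Q where "Q = P \<union> N3 \<union> N4"
  have csets: "X \<in> sets M" if "countable X" "X \<subseteq> \<Omega>" for X
    using that by (auto simp: in_sets intro: sets.countable)
  have P: "countable P" "P \<subseteq> \<Omega>" "P \<in> sets M"
    using N1 N2 csets by (auto simp: P_def)
  have Q: "Q \<in> sets M" using P N3 N4 by (auto simp: Q_def)
  have full: "emeasure N \<Omega> = emeasure N X"
    if "sets N = sets M" "Y \<subseteq> X" "X \<in> sets M" "Y \<in> sets M" "emeasure N (\<Omega> - Y) = 0" for N X Y
  proof -
    have "emeasure N \<Omega> = emeasure N X + emeasure N (\<Omega> - X)"
      using that \<Omega> in_sets by (subst plus_emeasure) (auto simp: Un_absorb1)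
    also have "emeasure N (\<Omega> - X) \<le> emeasure N (\<Omega> - Y)"
      by (rule emeasure_mono) (use that \<Omega> in_sets in auto)
    finally show ?thesis
      using that emeasure_mono[of X \<Omega> N] \<Omega> in_sets by (intro antisym) auto
  qed
  have Dfull: "emeasure D \<Omega> = emeasure D P" "emeasure D \<Omega> = emeasure D Q"
    by (rule full[of _ N1]; use sets P Q N1 csets in \<open>auto simp: P_def Q_def\<close>)+
  have D'full: "emeasure D' \<Omega> = emeasure D' P" "emeasure D' \<Omega> = emeasure D' Q"
    by (rule full[of _ N2]; use sets P Q N2 csets in \<open>auto simp: P_def Q_def\<close>)+
  have Sfull: "emeasure S \<Omega> = emeasure S Q"
    by (rule full[of _ N3]; use sets P Q N3 in \<open>auto simp: Q_def\<close>)
  have S'full: "emeasure S' \<Omega> = emeasure S' Q"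
    by (rule full[of _ N4]; use sets P Q N4 in \<open>auto simp: Q_def\<close>)
  have Snull: "emeasure T P = 0" if "singular_measure T" "sets T = sets M" for T
  proof -
    have "emeasure T P = (\<integral>\<^sup>+x. emeasure T {x} \<partial>count_space P)"
      by (rule emeasure_countable_singleton) (use that P in \<open>auto simp: in_sets\<close>)
    also have "\<dots> = (\<integral>\<^sup>+x. 0 \<partial>count_space P)"
      using that P sets_eq_imp_space_eq[OF that(2)] sp
      by (intro nn_integral_cong) (auto simp: singular_measure_def)
    finally show ?thesis by simp
  qed
  have "P \<in> null_sets lborel" using P by (intro countable_imp_null_set_lborel)
  moreover have "N3 \<in> null_sets lborel" "N4 \<in> null_sets lborel" using N3 N4 in_sets by auto
  ultimately have lQ: "Q \<in> null_sets lborel" unfolding Q_def by auto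
  have Anull: "emeasure A X = 0" "emeasure A' X = 0" if "X \<in> sets M" "X \<in> null_sets lborel" for X
  proof -
    have "X \<in> null_sets (restrict_space lborel \<Omega>)"
      using that in_sets \<Omega> by (subst null_sets_restrict_space) auto
    then show "emeasure A X = 0" "emeasure A' X = 0"
      using ac by (auto simp: absolutely_continuous_def)
  qed
  have AP: "emeasure A P = 0" "emeasure A' P = 0" and AQ: "emeasure A Q = 0" "emeasure A' Q = 0"
    using Anull[of P] Anull[of Q] P Q lQ \<open>P \<in> null_sets lborel\<close> by auto
  have D: "emeasure D' \<Omega> = c * emeasure D \<Omega>"
    using c[OF P(3)] add[OF P(3)] AP Snull[OF sing(1)] Snull[OF sing(2)] sets Dfull D'full by simp
  have fin: "emeasure M \<Omega> \<noteq> \<infinity>" "emeasure M' \<Omega> \<noteq> \<infinity>"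
    using finite_measure.emeasure_finite[OF M(2)] finite_measure.emeasure_finite[OF M'(2)] by auto
  have \<Omega>M: "\<Omega> \<in> sets M" using \<Omega> in_sets by auto
  \<comment> \<open>Cancellation takes place among the primed masses, which are finite;
    \<open>c\<close> itself is allowed to be \<infinity>.\<close>
  have fin': "emeasure D' \<Omega> \<noteq> \<infinity>" "emeasure S' \<Omega> \<noteq> \<infinity>"
    using fin(2) add(2)[OF \<Omega>M] by auto
  have "emeasure D' \<Omega> + emeasure S' \<Omega> = emeasure D' \<Omega> + c * emeasure S \<Omega>"
    using c[OF Q] add[OF Q] AQ Dfull D'full Sfull S'full D by (simp add: distrib_left)
  then have S: "emeasure S' \<Omega> = c * emeasure S \<Omega>"
    using fin' by (simp add: ennreal_add_left_cancel)
  have "emeasure S' \<Omega> + emeasure D' \<Omega> + emeasure A' \<Omega>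
      = emeasure S' \<Omega> + emeasure D' \<Omega> + c * emeasure A \<Omega>"
    using c[OF \<Omega>M] add[OF \<Omega>M] D S by (simp add: distrib_left ac_simps)
  then have A: "emeasure A' \<Omega> = c * emeasure A \<Omega>"
    using fin' by (simp add: ennreal_add_left_cancel)
  show "emeasure A' \<Omega> = c * emeasure A \<Omega>" "emeasure D' \<Omega> = c * emeasure D \<Omega>"
    "emeasure S' \<Omega> = c * emeasure S \<Omega>" by fact+
qed

subsection \<open>Generators of the cube\<close>

text \<open>A generator that is stable under intersection and also countable: equalities that hold
  almost everywhere for each interval then hold almost everywhere for all of them at once. The left
  end \<open>0\<close> matches lower boxes of the cube.\<close>

definition rational_intervals :: "real set set" where
  "rational_intervals = (\<lambda>q. {0..q}) ` (\<rat> \<inter> {0..1})"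

lemma rational_intervals_subset: "rational_intervals \<subseteq> Pow {0..1}"
  by (auto simp: rational_intervals_def)

lemma countable_rational_intervals: "countable rational_intervals"
  by (auto simp: rational_intervals_def countable_rat intro: countable_Int1)

lemma unit_in_rational_intervals: "{0..1} \<in> rational_intervals"
  by (auto simp: rational_intervals_def)

lemma Int_stable_rational_intervals: "Int_stable rational_intervals"
proof (rule Int_stableI)
  fix a b assume "a \<in> rational_intervals" "b \<in> rational_intervals"
  then obtain p q where "p \<in> \<rat> \<inter> {0..1}" "q \<in> \<rat> \<inter> {0..1}" "a = {0..p}" "b = {0..q}"
    by (auto simp: rational_intervals_def)
  then have "a \<inter> b = {0..min p q}" "min p q \<in> \<rat> \<inter> {0..1}" by (auto simp: min_def)
  then show "a \<inter> b \<in> rational_intervals" by (auto simp: rational_intervals_def)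
qed

lemma space_unit_interval [simp]: "space unit_interval = {0..1}"
  by (simp add: unit_interval_def space_restrict_space)

lemma in_sets_unit_interval: "X \<in> sets unit_interval \<longleftrightarrow> X \<in> sets borel \<and> X \<subseteq> {0..1}"
  unfolding unit_interval_def by (subst sets_restrict_space_iff) auto

text \<open>The inclusion of the Borel sets amounts to measurability of the identity for the
  generated sigma-algebra. The sublevel set at \<open>a\<close> with \<open>0 \<le> a < 1\<close> is
  the intersection of the rational intervals with right end in \<open>(a, 1]\<close>; the others are
  empty or everything.\<close>

lemma sets_unit_interval_eq: "sets unit_interval = sigma_sets {0..1} rational_intervals"
proof (rule antisym)
  have "rational_intervals \<subseteq> sets unit_interval"
    by (auto simp: rational_intervals_def in_sets_unit_interval)
  from sets.sigma_sets_subset[OF this]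
  show "sigma_sets {0..1} rational_intervals \<subseteq> sets unit_interval" by simp
  define S where "S = sigma {0..1::real} rational_intervals"
  have sS: "sets S = sigma_sets {0..1} rational_intervals" "space S = {0..1}"
    using rational_intervals_subset by (auto simp: S_def)
  have "(\<lambda>x. x) \<in> borel_measurable S"
  proof (rule borel_measurableI_le)
    fix a :: real
    show "{x \<in> space S. x \<le> a} \<in> sets S"
    proof -
      consider "a < 0" | "0 \<le> a" "a < 1" | "1 \<le> a" by linarith
      then show ?thesis
      proof cases
        case 1
        then have "{x \<in> space S. x \<le> a} = {}" by (auto simp: sS)
        then show ?thesis by (simp only: sets.empty_sets)
      next
        case 2
        have "{x \<in> space S. x \<le> a} = (\<Inter>q\<in>\<rat> \<inter> {a<..1}. {0..q})"
        proof (intro set_eqI iffI)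
          fix x assume x: "x \<in> (\<Inter>q\<in>\<rat> \<inter> {a<..1}. {0..q})"
          have "x \<le> a"
          proof (rule ccontr)
            assume "\<not> x \<le> a"
            then obtain q where "q \<in> \<rat>" "a < q" "q < min x 1"
              using Rats_dense_in_real[of a "min x 1"] 2 by auto
            then have "q \<in> \<rat> \<inter> {a<..1}" "q < x" by auto
            with x show False by (meson INT_D atLeastAtMost_iff not_le)
          qed
          moreover have "1 \<in> \<rat> \<inter> {a<..1}" using 2 by simp
          then have "x \<in> {0..1}" using x by blast
          ultimately show "x \<in> {x \<in> space S. x \<le> a}" by (auto simp: sS)
        qed (use 2 in \<open>auto simp: sS\<close>)
        also have "\<dots> \<in> sets S"
        proof (rule sets.countable_INT')
          show "countable (\<rat> \<inter> {a<..1})" by (intro countable_Int1 countable_rat)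
          have "1 \<in> \<rat> \<inter> {a<..1}" using 2 by simp
          then show "\<rat> \<inter> {a<..1} \<noteq> {}" by blast
          show "(\<lambda>q. {0..q}) ` (\<rat> \<inter> {a<..1}) \<subseteq> sets S"
            using 2 by (auto simp: sS rational_intervals_def intro!: sigma_sets.Basic imageI)
        qed
        finally show ?thesis .
      next
        case 3
        then have "{x \<in> space S. x \<le> a} = space S" by (auto simp: sS)
        then show ?thesis by (metis sets.top)
      qed
    qed
  qed
  then have *: "Y \<inter> {0..1} \<in> sets S" if "Y \<in> sets borel" for Y
    using measurable_sets[OF _ that, of "\<lambda>x. x" S] by (simp add: sS(2) vimage_def Int_def)
  show "sets unit_interval \<subseteq> sigma_sets {0..1} rational_intervals"
  proof
    fix X assume "X \<in> sets unit_interval"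
    then have X: "X \<in> sets borel" "X \<inter> {0..1} = X" by (auto simp: in_sets_unit_interval)
    show "X \<in> sigma_sets {0..1} rational_intervals" using *[OF X(1)] by (simp only: X(2) sS(1))
  qed
qed

text \<open>Products of rational intervals form an intersection-stable generator of the Borel sets
  of the cube, and each such product is the lower box of the point formed by the right ends.\<close>

lemma cube_measure_eqI:
  assumes \<mu>: "prob_space \<mu>" "sets \<mu> = sets (cube d)"
    and \<nu>: "prob_space \<nu>" "sets \<nu> = sets (cube d)"
    and d: "0 < d"
    and eq: "\<And>x. x \<in> space (cube d) \<Longrightarrow>
      emeasure \<mu> {y \<in> space (cube d). \<forall>i<d. y i \<le> x i} = emeasure \<nu> {y \<in> space (cube d). \<forall>i<d. y i \<le> x i}"
  shows "\<mu> = \<nu>"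
proof -
  define P where "P = {{f\<in>(\<Pi>\<^sub>E i\<in>{..<d}. {0..1::real}). \<forall>i\<in>j. f i \<in> A i} | A j.
    j \<in> {{..<d}} \<and> A \<in> Pi j (\<lambda>_. rational_intervals)}"
  have P_I: "{f\<in>(\<Pi>\<^sub>E i\<in>{..<d}. {0..1::real}). \<forall>i\<in>{..<d}. f i \<in> A i} \<in> P"
    if "A \<in> {..<d} \<rightarrow> rational_intervals" for A
    using that unfolding P_def by blast
  have P_E: "\<exists>A. A \<in> {..<d} \<rightarrow> rational_intervals
      \<and> X = {f\<in>(\<Pi>\<^sub>E i\<in>{..<d}. {0..1::real}). \<forall>i\<in>{..<d}. f i \<in> A i}" if "X \<in> P" for X
    using that unfolding P_def by blast
  have "sets (cube d) = sets (\<Pi>\<^sub>M i\<in>{..<d}. sigma {0..1} rational_intervals)"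
    unfolding cube_def
    by (rule sets_PiM_cong) (auto simp: sets_unit_interval_eq rational_intervals_subset)
  also have "\<dots> = sets (sigma (\<Pi>\<^sub>E i\<in>{..<d}. {0..1}) P)"
    unfolding P_def
  proof (rule sets_PiM_sigma)
    show "\<exists>S\<subseteq>rational_intervals. countable S \<and> {0..1} = \<Union> S" for i :: nat
      using unit_in_rational_intervals by (intro exI[of _ "{{0..1}}"]) auto
  qed (auto simp: rational_intervals_subset)
  also have "\<dots> = sigma_sets (space (cube d)) P"
    unfolding space_cube using P_E by (intro sets_measure_of) blast
  finally have sets_eq: "sets (cube d) = sigma_sets (space (cube d)) P" .
  show ?thesis
  proof (rule measure_eqI_generator_eq[where \<Omega>="space (cube d)" and E=P and A="\<lambda>_. space (cube d)"])
    show "Int_stable P"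
    proof (rule Int_stableI)
      fix a b assume "a \<in> P" "b \<in> P"
      then obtain A B where AB: "A \<in> {..<d} \<rightarrow> rational_intervals" "B \<in> {..<d} \<rightarrow> rational_intervals"
        "a = {f\<in>(\<Pi>\<^sub>E i\<in>{..<d}. {0..1::real}). \<forall>i\<in>{..<d}. f i \<in> A i}"
        "b = {f\<in>(\<Pi>\<^sub>E i\<in>{..<d}. {0..1::real}). \<forall>i\<in>{..<d}. f i \<in> B i}"
        using P_E by meson
      then have "(\<lambda>i. A i \<inter> B i) \<in> {..<d} \<rightarrow> rational_intervals"
        using Int_stable_rational_intervals by (auto simp: Int_stable_def)
      moreover have "a \<inter> b = {f\<in>(\<Pi>\<^sub>E i\<in>{..<d}. {0..1::real}). \<forall>i\<in>{..<d}. f i \<in> A i \<inter> B i}"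
        unfolding AB(3,4) by blast
      ultimately show "a \<inter> b \<in> P" using P_I[of "\<lambda>i. A i \<inter> B i"] by simp
    qed
    show "P \<subseteq> Pow (space (cube d))" unfolding space_cube using P_E by blast
    fix X assume "X \<in> P"
    then obtain A where A: "A \<in> {..<d} \<rightarrow> rational_intervals"
      "X = {f\<in>(\<Pi>\<^sub>E i\<in>{..<d}. {0..1::real}). \<forall>i\<in>{..<d}. f i \<in> A i}"
      using P_E by meson
    have "\<forall>i\<in>{..<d}. \<exists>q. q \<in> {0..1} \<and> A i = {0..q}"
    proof
      fix i assume "i \<in> {..<d}"
      then have "A i \<in> rational_intervals" using A(1) by blast
      then show "\<exists>q. q \<in> {0..1} \<and> A i = {0..q}" unfolding rational_intervals_def by blast
    qed
    then obtain q where q: "\<And>i. i < d \<Longrightarrow> q i \<in> {0..1} \<and> A i = {0..q i}"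
      by (metis lessThan_iff)
    define x where "x = restrict q {..<d}"
    have x: "x \<in> space (cube d)" using q by (auto simp: x_def space_cube)
    have "X = {y \<in> space (cube d). \<forall>i<d. y i \<le> x i}"
      unfolding A(2) space_cube using q by (auto simp: x_def PiE_iff)
    then show "emeasure \<mu> X = emeasure \<nu> X" using eq[OF x] by simp
  next
    have "{f\<in>(\<Pi>\<^sub>E i\<in>{..<d}. {0..1::real}). \<forall>i\<in>{..<d}. f i \<in> {0..1}} \<in> P"
      by (rule P_I) (rule Pi_I, rule unit_in_rational_intervals)
    moreover have "space (cube d) = {f\<in>(\<Pi>\<^sub>E i\<in>{..<d}. {0..1::real}). \<forall>i\<in>{..<d}. f i \<in> {0..1}}"
      unfolding space_cube using PiE_mem by blast
    ultimately have "space (cube d) \<in> P" by (simp only:)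
    then show "range (\<lambda>_::nat. space (cube d)) \<subseteq> P" by blast
    show "emeasure \<mu> (space (cube d)) \<noteq> \<infinity>"
      using prob_space.emeasure_space_1[OF \<mu>(1)] sets_eq_imp_space_eq[OF \<mu>(2)] by simp
    show "sets \<mu> = sigma_sets (space (cube d)) P" "sets \<nu> = sigma_sets (space (cube d)) P"
      by (simp_all only: \<mu>(2) \<nu>(2) sets_eq)
  qed simp
qed

subsection \<open>Normalized generators and their pseudo-inverses\<close>

lemma normalized_generatorD:
  assumes "normalized_generator \<psi>"
  shows "\<And>z. 0 \<le> z \<Longrightarrow> 0 \<le> \<psi> z" "\<And>z. 0 \<le> z \<Longrightarrow> \<psi> z \<le> 1" "continuous_on {0..} \<psi>" "\<psi> 0 = 1"
    "\<And>a b. 0 \<le> a \<Longrightarrow> a \<le> b \<Longrightarrow> \<psi> b \<le> \<psi> a" "(\<psi> \<longlongrightarrow> 0) at_top" "antimono_on {0..} \<psi>"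
  using assms by (auto simp: normalized_generator_def monotone_on_def image_subset_iff)

lemma continuous_generator_max:
  assumes "normalized_generator \<psi>"
  shows "continuous_on UNIV (\<lambda>z. \<psi> (max 0 z))"
  by (rule continuous_on_compose2[OF normalized_generatorD(3)[OF assms]]) (auto intro!: continuous_intros)

text \<open>A Galois connection that translates lower boxes of the cube into corners of simplices.
  If \<open>\<psi> a \<le> y\<close>, the intermediate value theorem provides a solution of
  \<open>\<psi> z = y\<close> with \<open>z \<le> a\<close>. If \<open>y < \<psi> a\<close>,
  continuity gives some \<open>c > a\<close> with \<open>y < \<psi> c\<close>, and by monotonicity
  every solution, including \<infinity>, lies at or beyond \<open>c\<close>, hence so does the
  infimum.\<close>

lemma pseudo_inverse_le_iff:
  assumes gen: "normalized_generator \<psi>" and y: "0 \<le> y" "y \<le> 1" and a: "0 \<le> a"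
  shows "pseudo_inverse \<psi> y \<le> ennreal a \<longleftrightarrow> \<psi> a \<le> y"
proof
  assume "\<psi> a \<le> y"
  moreover have "continuous_on {0..a} \<psi>"
    by (rule continuous_on_subset[OF normalized_generatorD(3)[OF gen]]) auto
  ultimately obtain z where z: "0 \<le> z" "z \<le> a" "\<psi> z = y"
    using IVT2'[of \<psi> a y 0] a y normalized_generatorD(4)[OF gen] by auto
  then have "pseudo_inverse \<psi> y \<le> ennreal z"
    unfolding pseudo_inverse_def by (intro Inf_lower) (auto simp: generator_ext_def)
  also have "\<dots> \<le> ennreal a" using z by (simp add: ennreal_leI)
  finally show "pseudo_inverse \<psi> y \<le> ennreal a" .
next
  assume le: "pseudo_inverse \<psi> y \<le> ennreal a"
  show "\<psi> a \<le> y"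
  proof (rule ccontr)
    assume "\<not> \<psi> a \<le> y"
    then have ya: "y < \<psi> (max 0 a)" using a by simp
    have "isCont (\<lambda>z. \<psi> (max 0 z)) a"
      using continuous_generator_max[OF gen] by (simp add: continuous_on_eq_continuous_at)
    then have "\<forall>\<^sub>F z in at a. y < \<psi> (max 0 z)"
      using ya unfolding isCont_def by (rule order_tendstoD)
    then have "\<forall>\<^sub>F z in at_right a. y < \<psi> (max 0 z)"
      by (simp add: eventually_at_split)
    then obtain b where b: "b > a" "\<And>z. a < z \<Longrightarrow> z < b \<Longrightarrow> y < \<psi> (max 0 z)"
      unfolding eventually_at_right_field by blast
    define c where "c = (a + b) / 2"
    have c: "a < c" "y < \<psi> c" using b(1) b(2)[of c] a by (auto simp: c_def)
    have "ennreal c \<le> pseudo_inverse \<psi> y"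
      unfolding pseudo_inverse_def
    proof (rule Inf_greatest)
      fix z assume "z \<in> {z. generator_ext \<psi> z = y}"
      then have z: "generator_ext \<psi> z = y" by simp
      show "ennreal c \<le> z"
      proof (cases z)
        case (real r)
        then have r: "\<psi> r = y" using z by (simp add: generator_ext_def)
        have "c \<le> r"
        proof (rule ccontr)
          assume "\<not> c \<le> r"
          then have "\<psi> c \<le> \<psi> r" using normalized_generatorD(5)[OF gen, of r c] real by simp
          with r c show False by simp
        qed
        then show ?thesis using real by (simp add: ennreal_leI)
      qed simp
    qed
    with le have "ennreal c \<le> ennreal a" by (rule order_trans[rotated])
    then show False using c a by simp
  qed
qed

lemma pseudo_inverse_measurable:
  assumes gen: "normalized_generator \<psi>"
  shows "(\<lambda>y. enn2real (pseudo_inverse \<psi> y)) \<in> borel_measurable unit_interval"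
proof -
  have "pseudo_inverse \<psi> \<in> borel_measurable unit_interval"
  proof (rule borel_measurableI_le)
    fix b :: ennreal
    show "{y \<in> space unit_interval. pseudo_inverse \<psi> y \<le> b} \<in> sets unit_interval"
    proof (cases b)
      case (real a)
      have "{y \<in> space unit_interval. pseudo_inverse \<psi> y \<le> b} = {0..1} \<inter> {\<psi> a..}"
        using pseudo_inverse_le_iff[OF gen] real by auto
      then show ?thesis by (simp add: in_sets_unit_interval)
    next
      case top
      have "{y \<in> space unit_interval. pseudo_inverse \<psi> y \<le> b} = space unit_interval"
        by (auto simp: top)
      then show ?thesis by (metis sets.top)
    qed
  qed
  then show ?thesis by measurable
qed

lemma archimedean_eq:
  assumes "\<And>i. i < d \<Longrightarrow> pseudo_inverse \<psi> (x i) = ennreal (a i)" "\<And>i. i < d \<Longrightarrow> 0 \<le> a i"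
  shows "archimedean d \<psi> x = \<psi> (\<Sum>i<d. a i)"
proof -
  have "(\<Sum>i<d. pseudo_inverse \<psi> (x i)) = ennreal (\<Sum>i<d. a i)"
    using assms by (subst sum_ennreal[symmetric]) auto
  moreover have "0 \<le> (\<Sum>i<d. a i)" using assms(2) by (intro sum_nonneg) auto
  ultimately show ?thesis by (simp add: archimedean_def generator_ext_def)
qed

lemma archimedean_eq_0:
  assumes "i < d" "pseudo_inverse \<psi> (x i) = \<infinity>"
  shows "archimedean d \<psi> x = 0"
proof -
  have "(\<Sum>i<d. pseudo_inverse \<psi> (x i)) = \<infinity>"
    using assms by (subst sum.remove[of _ i]) auto
  then show ?thesis by (simp add: archimedean_def generator_ext_def)
qed

subsection \<open>Transport of a decomposition to the real line\<close>

lemma emeasure_distr_restricted_borel: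
  assumes "sets M = sets (restrict_space borel \<Omega>)" "X \<in> sets borel"
  shows "emeasure (distr M borel (\<lambda>x. x)) X = emeasure M (X \<inter> \<Omega>)"
proof -
  have "(\<lambda>x. x) \<in> M \<rightarrow>\<^sub>M borel"
    unfolding measurable_cong_sets[OF assms(1) refl] by (rule measurable_restrict_space1) simp
  moreover have "space M = \<Omega>" using sets_eq_imp_space_eq[OF assms(1)] by (simp add: space_restrict_space)
  ultimately show ?thesis using assms by (simp add: emeasure_distr)
qed

text \<open>Regarding the measures as measures on the whole line frees later arguments from the
  carrier \<Omega>. The three properties survive because a Borel set is merely intersected with
  \<Omega>, which preserves null sets and countable sets.\<close>

lemma lebesgue_decomposition_distr_borel:
  assumes dec: "lebesgue_decomposition M A D S" 
    and sM: "sets M = sets (restrict_space borel \<Omega>)" and \<Omega>: "\<Omega> \<in> sets borel"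
  shows "lebesgue_decomposition (distr M borel (\<lambda>x. x)) (distr A borel (\<lambda>x. x))
    (distr D borel (\<lambda>x. x)) (distr S borel (\<lambda>x. x))"
proof -
  note dec' = dec[unfolded lebesgue_decomposition_def]
  have sets: "sets A = sets (restrict_space borel \<Omega>)" "sets D = sets (restrict_space borel \<Omega>)"
    "sets S = sets (restrict_space borel \<Omega>)" using dec' sM by auto
  have spM: "space M = \<Omega>" using sets_eq_imp_space_eq[OF sM] by (simp add: space_restrict_space)
  have spaces: "space A = \<Omega>" "space D = \<Omega>" "space S = \<Omega>"
    using sets[THEN sets_eq_imp_space_eq] by (auto simp: space_restrict_space)
  have in_sets: "X \<in> sets M \<longleftrightarrow> X \<in> sets borel \<and> X \<subseteq> \<Omega>" for X
    unfolding sM using \<Omega> by (subst sets_restrict_space_iff) auto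
  have id: "(\<lambda>x. x) \<in> N \<rightarrow>\<^sub>M borel" if "sets N = sets (restrict_space borel \<Omega>)" for N
    unfolding measurable_cong_sets[OF that refl] by (rule measurable_restrict_space1) simp
  have fin: "finite_measure (distr N borel (\<lambda>x. x))" if "finite_measure N" "sets N = sets (restrict_space borel \<Omega>)" for N
    using that id by (intro finite_measure.finite_measure_distr)
  have ac: "absolutely_continuous lborel (distr A borel (\<lambda>x. x))"
    unfolding absolutely_continuous_def
  proof
    fix X :: "real set" assume X: "X \<in> null_sets lborel"
    then have "X \<inter> \<Omega> \<in> null_sets lborel" using \<Omega> by (intro null_set_Int2) auto
    then have "X \<inter> \<Omega> \<in> null_sets (restrict_space lborel \<Omega>)"
      using \<Omega> by (subst null_sets_restrict_space) auto
    then have "emeasure A (X \<inter> \<Omega>) = 0"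
      using dec' spM by (auto simp: absolutely_continuous_def)
    then show "X \<in> null_sets (distr A borel (\<lambda>x. x))"
      using X sets by (auto simp: emeasure_distr_restricted_borel null_sets_def)
  qed
  have eq: "(UNIV - N) \<inter> \<Omega> = \<Omega> - N" for N by auto
  have D: "discrete_measure (distr D borel (\<lambda>x. x))"
  proof -
    obtain N where N: "countable N" "N \<subseteq> \<Omega>" "emeasure D (\<Omega> - N) = 0" "finite_measure D"
      using dec' spaces by (auto simp: discrete_measure_def)
    then have "emeasure (distr D borel (\<lambda>x. x)) (UNIV - N) = 0"
      using sets eq[of N] by (subst emeasure_distr_restricted_borel) (auto simp: sets.countable)
    then show ?thesis using N fin sets by (auto simp: discrete_measure_def)
  qed
  have S: "singular_measure (distr S borel (\<lambda>x. x))"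
  proof -
    have s: "finite_measure S" "\<And>x. x \<in> \<Omega> \<Longrightarrow> emeasure S {x} = 0"
      using dec' spaces by (auto simp: singular_measure_def)
    obtain N where N: "N \<in> sets M" "emeasure lborel N = 0" "emeasure S (\<Omega> - N) = 0"
      using dec' spaces sM sets by (auto simp: singular_measure_def)
    then have "emeasure (distr S borel (\<lambda>x. x)) (UNIV - N) = 0"
      using sets in_sets eq[of N] by (subst emeasure_distr_restricted_borel) auto
    moreover have "emeasure (distr S borel (\<lambda>x. x)) {x} = 0" for x
      using sets s by (subst emeasure_distr_restricted_borel) (auto simp: Int_insert_left)
    ultimately show ?thesis using N in_sets s fin sets by (auto simp: singular_measure_def)
  qed
  have "emeasure (distr M borel (\<lambda>x. x)) X = emeasure (distr A borel (\<lambda>x. x)) X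
      + emeasure (distr D borel (\<lambda>x. x)) X + emeasure (distr S borel (\<lambda>x. x)) X"
    if "X \<in> sets borel" for X
  proof -
    have "X \<inter> \<Omega> \<in> sets M" using that \<Omega> in_sets by auto
    then show ?thesis
      using dec' that sets sM by (simp add: emeasure_distr_restricted_borel)
  qed
  then show ?thesis
    using ac D S unfolding lebesgue_decomposition_def
    by (auto simp: absolutely_continuous_def null_sets_restrict_space)
qed

subsection \<open>Rays through a Dirichlet simplex\<close>

abbreviation lborel_pow :: "nat \<Rightarrow> (nat \<Rightarrow> real) measure" where
  "lborel_pow n \<equiv> \<Pi>\<^sub>M i\<in>{..<n}. lborel"

text \<open>For fixed \<open>t > 0\<close> this is the density of the first \<open>n\<close> coordinates of a point distributed
  uniformly on the simplex \<open>{x \<ge> 0. x\<^sub>0 + \<dots> + x\<^sub>n = 1 / t}\<close>.\<close>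

definition simplex_density :: "nat \<Rightarrow> (nat \<Rightarrow> real) \<Rightarrow> real \<Rightarrow> ennreal" where
  "simplex_density n x t =
    (if (\<forall>i<n. 0 \<le> x i) \<and> 0 < t \<and> t * (\<Sum>i<n. x i) \<le> 1 then ennreal (fact n * t ^ n) else 0)"

lemma simplex_density_measurable [measurable (raw)]:
  assumes [measurable]: "f \<in> M \<rightarrow>\<^sub>M lborel_pow n" "g \<in> borel_measurable M"
  shows "(\<lambda>w. simplex_density n (f w) (g w)) \<in> borel_measurable M"
proof -
  have [measurable]: "(\<lambda>w. f w i) \<in> borel_measurable M" if "i < n" for i
    using measurable_compose[OF assms(1) measurable_component_singleton[of i "{..<n}" "\<lambda>_. lborel"]] that
    by simp
  have "(\<lambda>w. if (\<forall>i\<in>{..<n}. 0 \<le> f w i) \<and> 0 < g w \<and> g w * (\<Sum>i<n. f w i) \<le> 1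
      then ennreal (fact n * g w ^ n) else 0) \<in> borel_measurable M"
    by measurable
  then show ?thesis by (simp add: simplex_density_def Ball_def)
qed

text \<open>For fixed \<open>t\<close> this is the probability that a uniform point of the simplex
  has its first \<open>n\<close> coordinates above \<open>a\<close> and its last one,
  \<open>1 / t\<close> minus their sum, above \<open>b\<close>. Scaling the corner volume by
  \<open>fact n * t ^ n\<close> turns it into the integrand of the Williamson transform.\<close>

lemma nn_integral_simplex_density:
  assumes n: "1 \<le> n" and t: "0 < t" and a: "\<And>i. i < n \<Longrightarrow> 0 \<le> a i" and b: "0 \<le> b"
  shows "(\<integral>\<^sup>+x. simplex_density n x t * indicator {x. (\<forall>i<n. a i \<le> x i) \<and> (\<Sum>i<n. x i) \<le> 1 / t - b} x
      \<partial>lborel_pow n) = ennreal (max 0 (1 - t * ((\<Sum>i<n. a i) + b)) ^ n)"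
proof -
  let ?s = "\<Sum>i<n. a i"
  have "(\<integral>\<^sup>+x. simplex_density n x t * indicator {x. (\<forall>i<n. a i \<le> x i) \<and> (\<Sum>i<n. x i) \<le> 1 / t - b} x \<partial>lborel_pow n)
    = (\<integral>\<^sup>+x. ennreal (fact n * t ^ n) * indicator {x. (\<forall>i<n. a i \<le> x i) \<and> (\<Sum>i<n. x i) \<le> 1 / t - b} x \<partial>lborel_pow n)"
  proof (intro nn_integral_cong)
    fix x
    show "simplex_density n x t * indicator {x. (\<forall>i<n. a i \<le> x i) \<and> (\<Sum>i<n. x i) \<le> 1 / t - b} x
      = ennreal (fact n * t ^ n) * indicator {x. (\<forall>i<n. a i \<le> x i) \<and> (\<Sum>i<n. x i) \<le> 1 / t - b} x"
    proof (cases "(\<forall>i<n. a i \<le> x i) \<and> (\<Sum>i<n. x i) \<le> 1 / t - b")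
      case True
      then have "\<forall>i<n. 0 \<le> x i" using a by (meson order_trans)
      moreover have "(\<Sum>i<n. x i) \<le> 1 / t" using True b by linarith
      then have "t * (\<Sum>i<n. x i) \<le> 1" using t by (simp add: pos_le_divide_eq mult.commute)
      ultimately show ?thesis using t by (simp add: simplex_density_def)
    qed auto
  qed
  also have "\<dots> = ennreal (fact n * t ^ n) * (\<integral>\<^sup>+x. indicator {x. (\<forall>i<n. a i \<le> x i) \<and> (\<Sum>i<n. x i) \<le> 1 / t - b} x \<partial>lborel_pow n)"
    by (rule nn_integral_cmult) measurable
  also have "\<dots> = ennreal (fact n * t ^ n) * (if ?s \<le> 1 / t - b then ennreal ((1 / t - b - ?s) ^ n / fact n) else 0)"
    by (subst nn_integral_corner_simplex) simp
  also have "\<dots> = ennreal (max 0 (1 - t * (?s + b)) ^ n)"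
  proof (cases "?s \<le> 1 / t - b")
    case True
    have eq: "1 - t * (?s + b) = t * (1 / t - b - ?s)" using t by (simp add: field_simps)
    have nn: "0 \<le> 1 / t - b - ?s" using True by simp
    then have "max 0 (1 - t * (?s + b)) ^ n = t ^ n * (1 / t - b - ?s) ^ n"
      unfolding eq using t by (simp add: power_mult_distrib)
    then show ?thesis using True t nn by (simp add: ennreal_mult[symmetric] del: diff_ge_0_iff_ge)
  next
    case False
    then have "1 / t < ?s + b" by simp
    then have "1 < (?s + b) * t" using t by (simp add: pos_divide_less_eq)
    \<comment> \<open>The truncated power is \<open>0 ^ n\<close>, which vanishes because
      \<open>n\<close> is positive.\<close>
    then show ?thesis using False n by (simp add: mult.commute)
  qed
  finally show ?thesis .
qed

lemma nn_integral_simplex_density_full: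
  assumes n: "1 \<le> n" and t: "0 < t"
  shows "(\<integral>\<^sup>+x. simplex_density n x t \<partial>lborel_pow n) = 1"
proof -
  have "(\<integral>\<^sup>+x. simplex_density n x t \<partial>lborel_pow n) = 
    (\<integral>\<^sup>+x. simplex_density n x t * indicator {x. (\<forall>i<n. 0 \<le> x i) \<and> (\<Sum>i<n. x i) \<le> 1 / t - 0} x \<partial>lborel_pow n)"
    using t by (intro nn_integral_cong) (auto simp: simplex_density_def indicator_def pos_le_divide_eq mult.commute)
  also have "\<dots> = ennreal (max 0 (1 - t * ((\<Sum>i<n. 0) + 0)) ^ n)"
    by (rule nn_integral_simplex_density) (use n t in auto)
  finally show ?thesis by simp
qed

text \<open>For \<beta> = \<gamma> this is the Lebesgue density at \<open>x\<close> of the first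
  \<open>n\<close> coordinates of the random simplex point; for a part of \<gamma> it is the
  contribution of that part.\<close>

definition fiber_mass :: "nat \<Rightarrow> real measure \<Rightarrow> (nat \<Rightarrow> real) \<Rightarrow> ennreal" where
  "fiber_mass n \<beta> x = (\<integral>\<^sup>+t. simplex_density n x t \<partial>\<beta>)"

lemma fiber_mass_measurable [measurable]:
  assumes "finite_measure \<beta>" and [measurable_cong]: "sets \<beta> = sets borel"
  shows "fiber_mass n \<beta> \<in> borel_measurable (lborel_pow n)"
proof -
  interpret finite_measure \<beta> by fact
  show ?thesis unfolding fiber_mass_def by measurable
qed

lemma sigma_finite_lborel_pow: "sigma_finite_measure (lborel_pow n)"
  by (rule lborel_product.sigma_finite) simp

lemma pair_sigma_finite_lborel_pow:
  assumes "finite_measure \<beta>"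
  shows "pair_sigma_finite (lborel_pow n) \<beta>"
  by (rule pair_sigma_finite.intro[OF sigma_finite_lborel_pow finite_measure.axioms(1)[OF assms]])

text \<open>By Tonelli \<open>x\<close> is integrated out first, and for every \<open>t > 0\<close>
  the simplex density has integral 1.\<close>

lemma nn_integral_fiber_mass:
  assumes n: "1 \<le> n" and fin: "finite_measure \<beta>" and [measurable_cong]: "sets \<beta> = sets borel"
    and pos: "AE t in \<beta>. 0 < t"
  shows "(\<integral>\<^sup>+x. fiber_mass n \<beta> x \<partial>lborel_pow n) = emeasure \<beta> UNIV"
proof -
  interpret pair_sigma_finite "lborel_pow n" \<beta> by (rule pair_sigma_finite_lborel_pow[OF fin])
  have "(\<integral>\<^sup>+x. fiber_mass n \<beta> x \<partial>lborel_pow n) = (\<integral>\<^sup>+t. (\<integral>\<^sup>+x. simplex_density n x t \<partial>lborel_pow n) \<partial>\<beta>)"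
    unfolding fiber_mass_def by (rule Fubini'[symmetric]) measurable
  also have "\<dots> = (\<integral>\<^sup>+t. 1 \<partial>\<beta>)"
    using pos by (intro nn_integral_cong_AE) (auto simp: nn_integral_simplex_density_full[OF n])
  also have "\<dots> = emeasure \<beta> UNIV"
    using sets_eq_imp_space_eq[OF \<open>sets \<beta> = sets borel\<close>] by simp
  finally show ?thesis .
qed

text \<open>The dimension is \<open>Suc n\<close>, and \<gamma> is regarded as a measure on the
  whole line; its concentration on positive numbers is expressed by \<open>AE_pos\<close> instead of
  by its carrier.\<close>

locale williamson =
  fixes n :: nat and \<psi> :: "real \<Rightarrow> real" and \<gamma> :: "real measure"
  assumes n_pos: "1 \<le> n" and prob: "prob_space \<gamma>" and sets_\<gamma> [measurable_cong]: "sets \<gamma> = sets borel"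
    and AE_pos: "AE t in \<gamma>. 0 < t" and generator: "normalized_generator \<psi>"
    and transform: "\<And>z. 0 \<le> z \<Longrightarrow> \<psi> z = williamson_transform (Suc n) \<gamma> z"
begin

sublocale prob_space \<gamma> by (rule prob)

section \<open>Convexity, strict decrease and inversion of the generator\<close>

lemmas psi = normalized_generatorD[OF generator]

lemma truncated_power_integrable:
  assumes "0 \<le> z"
  shows "integrable \<gamma> (\<lambda>t. max 0 (1 - t * z) ^ n)"
proof (rule integrable_const_bound[where B=1])
  show "AE t in \<gamma>. norm (max 0 (1 - t * z) ^ n) \<le> 1"
    using AE_pos by eventually_elim (use assms in \<open>auto intro!: power_le_one\<close>)
qed measurable

lemma psi_eq: "0 \<le> z \<Longrightarrow> \<psi> z = (LINT t|\<gamma>. max 0 (1 - t * z) ^ n)"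
  using transform by (simp add: williamson_transform_def)

lemma psi_convex: "convex_on {0..} \<psi>"
proof (rule convex_onI)
  fix u x y :: real assume u: "0 < u" "u < 1" and xy: "x \<in> {0..}" "y \<in> {0..}"
  let ?f = "\<lambda>z t. max 0 (1 - t * z) ^ n"
  have nn: "0 \<le> (1 - u) * x + u * y" using u xy by simp
  have "\<psi> ((1 - u) * x + u * y) = (LINT t|\<gamma>. ?f ((1 - u) * x + u * y) t)"
    by (rule psi_eq[OF nn])
  also have "\<dots> \<le> (LINT t|\<gamma>. (1 - u) * ?f x t + u * ?f y t)"
    using u xy nn
    by (intro integral_mono truncated_power_convex_combination_le Bochner_Integration.integrable_add
        integrable_mult_right truncated_power_integrable) auto
  also have "\<dots> = (1 - u) * \<psi> x + u * \<psi> y"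
    using xy by (simp add: psi_eq truncated_power_integrable)
  finally show "\<psi> ((1 - u) *\<^sub>R x + u *\<^sub>R y) \<le> (1 - u) * \<psi> x + u * \<psi> y" by simp
qed simp

text \<open>A flat piece on \<open>[a, b]\<close> would by convexity force non-negative slopes to
  the right of \<open>b\<close>, so \<psi> would stay above \<open>\<psi> a > 0\<close> and could
  not tend to 0.\<close>

lemma psi_strict:
  assumes "0 \<le> a" "a < b" "0 < \<psi> a"
  shows "\<psi> b < \<psi> a"
proof (rule ccontr)
  assume "\<not> \<psi> b < \<psi> a"
  then have eq: "\<psi> b = \<psi> a" using psi(5)[of a b] assms by simp
  have "\<psi> b \<le> \<psi> c" if "b < c" for c
  proof -
    have "(\<psi> b - \<psi> a) / (b - a) \<le> (\<psi> c - \<psi> b) / (c - b)"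
      by (rule convex_on_slope_mono[OF psi_convex]) (use assms that in auto)
    then show ?thesis using that eq by (simp add: zero_le_divide_iff)
  qed
  then have "\<forall>\<^sub>F c in at_top. \<psi> b \<le> \<psi> c"
    by (rule eventually_mono[OF eventually_gt_at_top[of b]])
  then have "\<psi> b \<le> 0" using psi(6) by (intro tendsto_lowerbound[of \<psi> 0 at_top]) auto
  then show False using eq assms by simp
qed

text \<open>The radius \<open>1 / t\<close> does not exceed the first zero of \<open>\<psi>\<close>.\<close>

definition admissible :: "real \<Rightarrow> bool" where
  "admissible t \<longleftrightarrow> 0 < t \<and> (\<forall>w. 0 \<le> w \<longrightarrow> t * w < 1 \<longrightarrow> 0 < \<psi> w)"

text \<open>If \<psi> has zeros, continuity makes the first one a minimum \<open>Inf Z\<close>.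
  There the integral of the non-negative truncated power vanishes, so
  \<open>1 \<le> t * Inf Z\<close> for almost all \<open>t\<close>, and every \<open>w\<close> with
  \<open>t * w < 1\<close> lies before \<open>Inf Z\<close>. Without zeros, positivity of
  \<open>t\<close> is enough.\<close>

lemma AE_admissible: "AE t in \<gamma>. admissible t"
proof (cases "\<exists>w\<ge>0. \<psi> w = 0")
  case False
  then have "0 < \<psi> w" if "0 \<le> w" for w using psi(1)[OF that] that by (metis order_le_less)
  then show ?thesis using AE_pos by (auto simp: admissible_def)
next
  case True
  define Z where "Z = {w. 0 \<le> w \<and> \<psi> w = 0}"
  have "closed Z"
  proof -
    have "Z = {0..} \<inter> \<psi> -` {0}" by (auto simp: Z_def)
    then show ?thesis using continuous_closed_preimage[OF psi(3), of "{0}"] by simp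
  qed
  moreover have "Z \<noteq> {}" "bdd_below Z" using True by (auto simp: Z_def intro!: bdd_belowI[of _ 0])
  ultimately have "Inf Z \<in> Z" by (intro closed_contains_Inf)
  then have z: "0 \<le> Inf Z" "\<psi> (Inf Z) = 0" by (auto simp: Z_def)
  have "AE t in \<gamma>. max 0 (1 - t * Inf Z) ^ n = 0"
    using z psi_eq[OF z(1)]
    by (subst integral_nonneg_eq_0_iff_AE[symmetric]) (auto intro: truncated_power_integrable)
  then show ?thesis using AE_pos
  proof eventually_elim
    case (elim t)
    then have t: "1 \<le> t * Inf Z" using n_pos by (auto simp: max_def split: if_splits)
    have "0 < \<psi> w" if "0 \<le> w" "t * w < 1" for w
    proof (rule ccontr)
      assume "\<not> 0 < \<psi> w"
      then have "w \<in> Z" using psi(1)[OF that(1)] that by (auto simp: Z_def)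
      then have "Inf Z \<le> w" using \<open>bdd_below Z\<close> by (rule cInf_lower)
      then have "t * Inf Z \<le> t * w" using elim by simp
      with t that show False by simp
    qed
    then show ?case using elim by (simp add: admissible_def)
  qed
qed

text \<open>Every \<open>a < x\<close> satisfies \<open>t * a < 1\<close>, so \<psi> is positive at
  \<open>a\<close> and decreases strictly from there to \<open>x\<close>. Via the Galois connection
  the pseudo-inverse then has the same finite upper bounds as \<open>x\<close>. The case
  \<open>t * x = 1\<close> is included, so \<open>x\<close> may be the first zero itself.\<close>

lemma pseudo_inverse_psi:
  assumes "admissible t" "0 \<le> x" "t * x \<le> 1"
  shows "enn2real (pseudo_inverse \<psi> (\<psi> x)) = x"
proof -
  have le: "pseudo_inverse \<psi> (\<psi> x) \<le> ennreal a \<longleftrightarrow> x \<le> a" if "0 \<le> a" for a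
  proof -
    have "pseudo_inverse \<psi> (\<psi> x) \<le> ennreal a \<longleftrightarrow> \<psi> a \<le> \<psi> x"
      by (rule pseudo_inverse_le_iff[OF generator]) (use psi assms that in auto)
    also have "\<dots> \<longleftrightarrow> x \<le> a"
    proof
      assume *: "\<psi> a \<le> \<psi> x"
      show "x \<le> a"
      proof (rule ccontr)
        assume "\<not> x \<le> a"
        then have "a < x" by simp
        moreover have "0 < t" using assms by (simp add: admissible_def)
        ultimately have "t * a < 1" using assms(3) by (smt (verit) mult_strict_left_mono)
        then have "\<psi> x < \<psi> a" using \<open>a < x\<close> assms that by (intro psi_strict) (auto simp: admissible_def)
        with * show False by simp
      qed
    qed (use psi(5)[of x a] assms in auto)
    finally show ?thesis .
  qed
  show ?thesis
  proof (cases "pseudo_inverse \<psi> (\<psi> x)")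
    case (real r)
    have "x \<le> r" using le[of r] real by simp
    moreover have "r \<le> x" using le[of x] real assms by simp
    ultimately show ?thesis using real by simp
  next
    case top
    then have "\<top> \<le> ennreal x" using le[of x] assms by simp
    then show ?thesis by (simp add: top_unique)
  qed
qed

end

subsection \<open>The conditional distribution along a ray\<close>

text \<open>Images and preimages under \<open>residual x\<close> are controlled below only as
  Lebesgue negligible sets, while the exceptional sets for Borel measures have to be Borel.\<close>

lemma negligible_imp_null_borel_superset:
  fixes S :: "real set"
  assumes "negligible S"
  shows "\<exists>N \<in> null_sets lborel. S \<subseteq> N"
  using assms unfolding negligible_iff_null_sets by (simp add: null_sets_completion_iff2)

context williamson
begin

text \<open>A generator is unspecified at negative arguments; this extension by
  \<open>\<psi> 0 = 1\<close> is continuous, hence Borel, on the whole line.\<close>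

definition \<psi>0 :: "real \<Rightarrow> real" where
  "\<psi>0 z = \<psi> (max 0 z)"

text \<open>All coordinates of the simplex point add up to \<open>1 / t\<close>, so the argument is
  its last coordinate.\<close>

definition residual :: "(nat \<Rightarrow> real) \<Rightarrow> real \<Rightarrow> real" where
  "residual x t = \<psi>0 (1 / t - (\<Sum>i<n. x i))"

text \<open>For \<beta> = \<gamma> this is the unnormalized conditional law of the last copula
  coordinate. Without normalization it is additive in \<beta>, so the parts of \<gamma> can be
  treated separately.\<close>

definition fiber :: "real measure \<Rightarrow> (nat \<Rightarrow> real) \<Rightarrow> real measure" where
  "fiber \<beta> x = distr (density \<beta> (simplex_density n x)) unit_interval (residual x)"

lemma psi0_range: "\<psi>0 z \<in> {0..1}"
  using psi(1,2)[of "max 0 z"] by (simp add: \<psi>0_def)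

lemma psi0_measurable [measurable]: "\<psi>0 \<in> borel \<rightarrow>\<^sub>M unit_interval"
  unfolding unit_interval_def
proof (rule measurable_restrict_space2)
  show "\<psi>0 \<in> borel_measurable borel"
    unfolding \<psi>0_def by (rule borel_measurable_continuous_onI[OF continuous_generator_max[OF generator]])
qed (use psi0_range in auto)

lemma residual_measurable [measurable (raw)]:
  assumes [measurable]: "f \<in> M \<rightarrow>\<^sub>M lborel_pow n" "g \<in> borel_measurable M"
  shows "(\<lambda>w. residual (f w) (g w)) \<in> M \<rightarrow>\<^sub>M unit_interval"
proof -
  have [measurable]: "(\<lambda>w. f w i) \<in> borel_measurable M" if "i < n" for i
    using measurable_compose[OF assms(1) measurable_component_singleton[of i "{..<n}" "\<lambda>_. lborel"]] that
    by simp
  show ?thesis unfolding residual_def by measurable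
qed

lemma sets_fiber [simp, measurable_cong]: "sets (fiber \<beta> x) = sets unit_interval"
  by (simp add: fiber_def)

lemma space_fiber [simp]: "space (fiber \<beta> x) = {0..1}"
  by (simp add: fiber_def)

lemma emeasure_fiber:
  assumes [measurable_cong]: "sets \<beta> = sets borel" and x [measurable]: "x \<in> space (lborel_pow n)"
    and F [measurable]: "F \<in> sets unit_interval"
  shows "emeasure (fiber \<beta> x) F = (\<integral>\<^sup>+t. simplex_density n x t * indicator F (residual x t) \<partial>\<beta>)"
proof -
  have sp: "space \<beta> = UNIV" using sets_eq_imp_space_eq[OF assms(1)] by simp
  have [measurable]: "residual x \<in> \<beta> \<rightarrow>\<^sub>M unit_interval" "simplex_density n x \<in> borel_measurable \<beta>"
    by measurable
  have m: "residual x -` F \<in> sets \<beta>"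
    using measurable_sets[of "residual x" \<beta> unit_interval F] by (simp add: sp)
  have "emeasure (fiber \<beta> x) F = emeasure (density \<beta> (simplex_density n x)) (residual x -` F)"
    unfolding fiber_def by (subst emeasure_distr) (auto simp: sp)
  also have "\<dots> = (\<integral>\<^sup>+t. simplex_density n x t * indicator (residual x -` F) t \<partial>\<beta>)"
    by (subst emeasure_density) (auto simp: m)
  finally show ?thesis by (simp add: indicator_def)
qed

lemma emeasure_fiber_full:
  assumes \<beta>: "sets \<beta> = sets borel" and x: "x \<in> space (lborel_pow n)"
  shows "emeasure (fiber \<beta> x) {0..1} = fiber_mass n \<beta> x"
proof -
  have "{0..1} \<in> sets unit_interval" by (simp add: in_sets_unit_interval)
  moreover have "residual x t \<in> {0..1}" for t unfolding residual_def by (rule psi0_range)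
  ultimately show ?thesis
    by (simp add: emeasure_fiber[OF \<beta> x] fiber_mass_def)
qed

text \<open>Where the density does not vanish, \<open>residual x\<close> is \<open>\<psi>\<close> after the diffeomorphism \<open>t \<mapsto> 1 / t - s\<close>.\<close>

lemma density_support:
  assumes "simplex_density n x t \<noteq> 0"
  shows "0 < t" "0 \<le> 1 / t - (\<Sum>i<n. x i)" "residual x t = \<psi> (1 / t - (\<Sum>i<n. x i))"
    "\<And>i. i < n \<Longrightarrow> 0 \<le> x i"
proof -
  have t: "0 < t" "t * (\<Sum>i<n. x i) \<le> 1" and x: "\<And>i. i < n \<Longrightarrow> 0 \<le> x i"
    using assms by (auto simp: simplex_density_def split: if_splits)
  show "0 < t" by fact
  show nn: "0 \<le> 1 / t - (\<Sum>i<n. x i)"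
    using t by (simp add: pos_le_divide_eq mult.commute)
  show "residual x t = \<psi> (1 / t - (\<Sum>i<n. x i))" using nn by (simp add: residual_def \<psi>0_def)
  show "0 \<le> x i" if "i < n" for i using x that by simp
qed

text \<open>A positive sum moves the argument strictly to the left of \<open>1 / t\<close>, where
  admissibility gives positivity.\<close>

lemma admissible_psi_pos:
  assumes "admissible t" "simplex_density n x t \<noteq> 0" "0 < (\<Sum>i<n. x i)"
  shows "0 < \<psi> (1 / t - (\<Sum>i<n. x i))"
proof -
  note d = density_support[OF assms(2)]
  have "t * (1 / t - (\<Sum>i<n. x i)) = 1 - t * (\<Sum>i<n. x i)" using d(1) by (simp add: right_diff_distrib)
  moreover have "0 < t * (\<Sum>i<n. x i)" using d(1) assms(3) by simp
  ultimately show ?thesis using assms(1) d(2) by (auto simp: admissible_def)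
qed

lemma residual_inj:
  assumes "admissible t" "simplex_density n x t \<noteq> 0" "admissible t'" "simplex_density n x t' \<noteq> 0"
    and s: "0 < (\<Sum>i<n. x i)" and eq: "residual x t = residual x t'"
  shows "t = t'"
proof -
  let ?z = "1 / t - (\<Sum>i<n. x i)" and ?z' = "1 / t' - (\<Sum>i<n. x i)"
  note d = density_support[OF assms(2)] and d' = density_support[OF assms(4)]
  have "?z = ?z'"
    using psi_strict[of ?z ?z'] psi_strict[of ?z' ?z] eq d d'
      admissible_psi_pos[OF assms(1,2) s] admissible_psi_pos[OF assms(3,4) s]
    by (cases ?z ?z' rule: linorder_cases) auto
  then show "t = t'" using d(1) d'(1) by simp
qed

text \<open>The set \<open>F\<close> is pulled back first through \<psi> and then through
  \<open>t \<mapsto> 1 / t - s\<close>, whose inverse \<open>z \<mapsto> 1 / (z + s)\<close> is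
  differentiable for \<open>z \<ge> 0\<close> because \<open>s > 0\<close>. Differentiable images of
  null sets are null.\<close>

lemma negligible_residual_vimage:
  assumes s: "0 < (\<Sum>i<n. x i)" and F: "negligible F"
  shows "negligible {t. simplex_density n x t \<noteq> 0 \<and> admissible t \<and> residual x t \<in> F}"
proof -
  let ?s = "\<Sum>i<n. x i"
  define Z where "Z = {z. 0 \<le> z \<and> 0 < \<psi> z \<and> \<psi> z \<in> F}"
  have "negligible Z" unfolding Z_def
    by (rule negligible_convex_antimono_vimage[OF psi_convex psi(7) psi_strict F])
  moreover have "(\<lambda>z. 1 / (z + ?s)) differentiable_on Z"
    using s by (intro differentiable_at_imp_differentiable_on differentiable_divide) (auto simp: Z_def)
  ultimately have "negligible ((\<lambda>z. 1 / (z + ?s)) ` Z)"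
    by (intro negligible_differentiable_image_negligible) auto
  moreover have "{t. simplex_density n x t \<noteq> 0 \<and> admissible t \<and> residual x t \<in> F} \<subseteq> (\<lambda>z. 1 / (z + ?s)) ` Z"
  proof
    fix t assume "t \<in> {t. simplex_density n x t \<noteq> 0 \<and> admissible t \<and> residual x t \<in> F}"
    then have t: "simplex_density n x t \<noteq> 0" "admissible t" "residual x t \<in> F" by auto
    have "1 / t - ?s \<in> Z"
      using density_support[OF t(1)] admissible_psi_pos[OF t(2,1) s] t(3) by (simp add: Z_def)
    then show "t \<in> (\<lambda>z. 1 / (z + ?s)) ` Z" by (rule rev_image_eqI) simp
  qed
  ultimately show ?thesis by (rule negligible_subset)
qed

text \<open>The differentiable map \<open>t \<mapsto> 1 / t - s\<close> is followed by \<psi>, which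
  preserves null sets away from \<open>0\<close>. The argument \<open>0\<close> contributes only the
  value \<open>\<psi> 0 = 1\<close>, whence the \<open>insert\<close>.\<close>

lemma negligible_residual_image:
  assumes N: "negligible N"
  shows "negligible (residual x ` (N \<inter> {t. simplex_density n x t \<noteq> 0}))"
proof -
  let ?s = "\<Sum>i<n. x i"
  define T where "T = N \<inter> {0<..}"
  have "negligible T" unfolding T_def by (rule negligible_subset[OF N]) auto
  moreover have "(\<lambda>t. 1 / t - ?s) differentiable_on T"
    by (intro differentiable_at_imp_differentiable_on differentiable_diff differentiable_divide)
      (auto simp: T_def)
  ultimately have "negligible ((\<lambda>t. 1 / t - ?s) ` T)"
    by (intro negligible_differentiable_image_negligible) auto
  then have "negligible ((\<lambda>t. 1 / t - ?s) ` T \<inter> {0<..})"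
    by (rule negligible_subset) auto
  then have "negligible (\<psi> ` ((\<lambda>t. 1 / t - ?s) ` T \<inter> {0<..}))"
    by (rule negligible_convex_antimono_image[OF psi_convex psi(7)]) auto
  then have "negligible (insert 1 (\<psi> ` ((\<lambda>t. 1 / t - ?s) ` T \<inter> {0<..})))"
    by (simp add: negligible_insert)
  moreover have "residual x ` (N \<inter> {t. simplex_density n x t \<noteq> 0})
      \<subseteq> insert 1 (\<psi> ` ((\<lambda>t. 1 / t - ?s) ` T \<inter> {0<..}))"
  proof
    fix y assume "y \<in> residual x ` (N \<inter> {t. simplex_density n x t \<noteq> 0})"
    then obtain t where t: "t \<in> N" "simplex_density n x t \<noteq> 0" "y = residual x t" by auto
    note d = density_support[OF t(2)]
    show "y \<in> insert 1 (\<psi> ` ((\<lambda>t. 1 / t - ?s) ` T \<inter> {0<..}))"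
    proof (cases "1 / t - ?s = 0")
      case True
      then show ?thesis using d t psi(4) by simp
    next
      case False
      then have "1 / t - ?s \<in> (\<lambda>t. 1 / t - ?s) ` T \<inter> {0<..}"
        using d t by (auto simp: T_def)
      then show ?thesis using d t by auto
    qed
  qed
  ultimately show ?thesis by (rule negligible_subset)
qed

section \<open>Transport of the Lebesgue decomposition to the fibers\<close>

context
  fixes A D S :: "real measure"
  assumes dec: "lebesgue_decomposition \<gamma> A D S"
begin

lemma decomposition_sets: "sets A = sets borel" "sets D = sets borel" "sets S = sets borel"
  using dec by (auto simp: lebesgue_decomposition_def sets_\<gamma>)

lemma decomposition_add:
  "X \<in> sets borel \<Longrightarrow> emeasure \<gamma> X = emeasure A X + emeasure D X + emeasure S X"
  using dec by (auto simp: lebesgue_decomposition_def sets_\<gamma>)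

lemma decomposition_AE:
  assumes "AE t in \<gamma>. P t"
  shows "AE t in A. P t" "AE t in D. P t" "AE t in S. P t"
proof -
  have "absolutely_continuous \<gamma> A" "absolutely_continuous \<gamma> D" "absolutely_continuous \<gamma> S"
    unfolding absolutely_continuous_def
    using decomposition_sets decomposition_add by (auto simp: null_sets_def sets_\<gamma>)
  then show "AE t in A. P t" "AE t in D. P t" "AE t in S. P t"
    using assms decomposition_sets sets_\<gamma> by (auto intro: absolutely_continuous_AE[where M=\<gamma>])
qed

lemma decomposition_finite: "finite_measure A" "finite_measure D" "finite_measure S"
proof -
  have "space A = UNIV" "space D = UNIV" "space S = UNIV"
    using decomposition_sets[THEN sets_eq_imp_space_eq] by auto
  moreover have "emeasure A UNIV \<noteq> \<infinity>" "emeasure D UNIV \<noteq> \<infinity>" "emeasure S UNIV \<noteq> \<infinity>"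
    using decomposition_add[of UNIV] emeasure_finite[of UNIV] by auto
  ultimately show "finite_measure A" "finite_measure D" "finite_measure S"
    by (auto intro: finite_measureI)
qed

lemma fiber_add:
  assumes [measurable]: "x \<in> space (lborel_pow n)" "F \<in> sets unit_interval"
  shows "emeasure (fiber \<gamma> x) F = emeasure (fiber A x) F + emeasure (fiber D x) F + emeasure (fiber S x) F"
  unfolding emeasure_fiber[OF sets_\<gamma> assms] emeasure_fiber[OF decomposition_sets(1) assms]
    emeasure_fiber[OF decomposition_sets(2) assms] emeasure_fiber[OF decomposition_sets(3) assms]
proof (rule nn_integral_add_measures)
  show "(\<lambda>t. simplex_density n x t * indicator F (residual x t)) \<in> borel_measurable \<gamma>"
    by measurable
qed (auto simp: decomposition_sets sets_\<gamma> decomposition_add)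

lemma fiber_mass_add:
  assumes "x \<in> space (lborel_pow n)"
  shows "fiber_mass n \<gamma> x = fiber_mass n A x + fiber_mass n D x + fiber_mass n S x"
  using fiber_add[OF assms, of "{0..1}"] assms
  by (simp add: emeasure_fiber_full sets_\<gamma> decomposition_sets in_sets_unit_interval)

lemma fiber_null:
  assumes "sets \<beta> = sets borel" "x \<in> space (lborel_pow n)" "F \<in> sets unit_interval"
    and "AE t in \<beta>. simplex_density n x t \<noteq> 0 \<longrightarrow> residual x t \<notin> F"
  shows "emeasure (fiber \<beta> x) F = 0"
proof -
  have "AE t in \<beta>. simplex_density n x t * indicator F (residual x t) = 0"
    using assms(4) by eventually_elim (auto simp: indicator_def)
  then have "(\<integral>\<^sup>+t. simplex_density n x t * indicator F (residual x t) \<partial>\<beta>) = (\<integral>\<^sup>+t. 0 \<partial>\<beta>)"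
    by (rule nn_integral_cong_AE)
  then show ?thesis by (simp add: emeasure_fiber[OF assms(1-3)])
qed

text \<open>Each part is pushed forward by \<open>residual x\<close>. Null preimages of null sets
  give absolute continuity and countable images of countable sets give discreteness. For the
  singular part, null images of null sets give the null carrier, and injectivity excludes atoms.
  Finite fiber mass is required because discrete and singular measures are finite by
  definition.\<close>

lemma fiber_lebesgue_decomposition:
  assumes x: "x \<in> space (lborel_pow n)" and s: "0 < (\<Sum>i<n. x i)" and fin: "fiber_mass n \<gamma> x \<noteq> \<infinity>"
  shows "lebesgue_decomposition (fiber \<gamma> x) (fiber A x) (fiber D x) (fiber S x)"
proof -
  note dec' = dec[unfolded lebesgue_decomposition_def]
  have sp: "space \<gamma> = UNIV" "space A = UNIV" "space D = UNIV" "space S = UNIV"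
    using sets_\<gamma>[THEN sets_eq_imp_space_eq] decomposition_sets[THEN sets_eq_imp_space_eq] by auto
  have "fiber_mass n D x \<noteq> \<infinity>" "fiber_mass n S x \<noteq> \<infinity>"
    using fin fiber_mass_add[OF x] by auto
  then have fm: "finite_measure (fiber D x)" "finite_measure (fiber S x)"
    using x decomposition_sets by (auto intro!: finite_measureI simp: emeasure_fiber_full)
  have AA: "AE t in A. t \<notin> N" if "N \<in> null_sets lborel" for N
  proof -
    have "N \<in> null_sets A"
      using dec' that sp by (auto simp: absolutely_continuous_def null_sets_restrict_space)
    then show ?thesis by (rule AE_not_in)
  qed
  have ac: "absolutely_continuous (restrict_space lborel {0..1}) (fiber A x)"
    unfolding absolutely_continuous_def
  proof
    fix F :: "real set" assume "F \<in> null_sets (restrict_space lborel {0..1})"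
    then have F: "F \<in> null_sets lborel" "F \<subseteq> {0..1}" by (auto simp: null_sets_restrict_space)
    then have Fm: "F \<in> sets unit_interval" by (auto simp: in_sets_unit_interval)
    have "negligible F" using F by (simp add: negligible_iff_null_sets null_sets_completionI)
    from negligible_imp_null_borel_superset[OF negligible_residual_vimage[OF s this]]
    obtain N where N: "N \<in> null_sets lborel"
      "{t. simplex_density n x t \<noteq> 0 \<and> admissible t \<and> residual x t \<in> F} \<subseteq> N" by blast
    have "AE t in A. simplex_density n x t \<noteq> 0 \<longrightarrow> residual x t \<notin> F"
      using AA[OF N(1)] decomposition_AE(1)[OF AE_admissible] by eventually_elim (use N(2) in auto)
    then have "emeasure (fiber A x) F = 0"
      by (rule fiber_null[OF decomposition_sets(1) x Fm])
    then show "F \<in> null_sets (fiber A x)" using Fm by auto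
  qed
  have disc: "discrete_measure (fiber D x)"
  proof -
    obtain N where N: "countable N" "emeasure D (UNIV - N) = 0"
      using dec' sp by (auto simp: discrete_measure_def)
    define N' where "N' = residual x ` N"
    have N': "countable N'" "N' \<subseteq> {0..1}" using N psi0_range by (auto simp: N'_def residual_def)
    have "N' \<in> sets borel" by (rule sets.countable[OF _ N'(1)]) simp
    then have m: "{0..1} - N' \<in> sets unit_interval" by (simp add: in_sets_unit_interval)
    have "N \<in> sets borel" by (rule sets.countable[OF _ N(1)]) simp
    then have "UNIV - N \<in> null_sets D" using N decomposition_sets by (auto simp: null_sets_def)
    from AE_not_in[OF this]
    have "AE t in D. simplex_density n x t \<noteq> 0 \<longrightarrow> residual x t \<notin> {0..1} - N'"
      by eventually_elim (auto simp: N'_def)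
    then have "emeasure (fiber D x) ({0..1} - N') = 0"
      by (rule fiber_null[OF decomposition_sets(2) x m])
    then show ?thesis using fm N' by (auto simp: discrete_measure_def)
  qed
  have sing: "singular_measure (fiber S x)"
  proof -
    have S0: "emeasure S {t} = 0" for t using dec' sp by (auto simp: singular_measure_def)
    have atom: "emeasure (fiber S x) {y} = 0" if y: "y \<in> {0..1}" for y
    proof -
      \<comment> \<open>Injectivity leaves at most one such \<open>t\<close>; if there is none, any
        \<open>t0\<close> serves.\<close>
      obtain t0 where t0: "\<And>t. admissible t \<Longrightarrow> simplex_density n x t \<noteq> 0 \<Longrightarrow> residual x t = y \<Longrightarrow> t = t0"
        using residual_inj[OF _ _ _ _ s] by metis
      have "{t0} \<in> null_sets S" using S0 decomposition_sets by (auto simp: null_sets_def)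
      from AE_not_in[OF this] decomposition_AE(3)[OF AE_admissible]
      have "AE t in S. simplex_density n x t \<noteq> 0 \<longrightarrow> residual x t \<notin> {y}"
        by eventually_elim (use t0 in auto)
      then show ?thesis
        using y by (intro fiber_null[OF decomposition_sets(3) x]) (auto simp: in_sets_unit_interval)
    qed
    obtain N where N: "N \<in> sets borel" "emeasure lborel N = 0" "emeasure S (UNIV - N) = 0"
      using dec' sp sets_\<gamma> by (auto simp: singular_measure_def)
    have "negligible N" using N by (simp add: negligible_iff_null_sets null_sets_completionI null_sets_def)
    from negligible_imp_null_borel_superset[OF negligible_residual_image[OF this]]
    obtain N' where N': "N' \<in> null_sets lborel"
      "residual x ` (N \<inter> {t. simplex_density n x t \<noteq> 0}) \<subseteq> N'" by blast
    have m: "N' \<inter> {0..1} \<in> sets unit_interval" "{0..1} - N' \<inter> {0..1} \<in> sets unit_interval"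
      using N' by (auto simp: in_sets_unit_interval)
    have "UNIV - N \<in> null_sets S" using N decomposition_sets by (auto simp: null_sets_def)
    from AE_not_in[OF this]
    have "AE t in S. simplex_density n x t \<noteq> 0 \<longrightarrow> residual x t \<notin> {0..1} - N' \<inter> {0..1}"
      by eventually_elim (use N' in auto)
    then have "emeasure (fiber S x) ({0..1} - N' \<inter> {0..1}) = 0"
      by (rule fiber_null[OF decomposition_sets(3) x m(2)])
    moreover have "N' \<inter> {0..1} \<in> null_sets lborel" using N' by (intro null_set_Int2) auto
    ultimately show ?thesis
      using fm(2) m(1) atom unfolding singular_measure_def by auto
  qed
  show ?thesis
    unfolding lebesgue_decomposition_def
    using ac disc sing fiber_add[OF x] by simp
qed

end

end

subsection \<open>The stochastic representation of the copula\<close>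

lemma measurable_cube_component:
  assumes "i < d"
  shows "(\<lambda>y. y i) \<in> cube d \<rightarrow>\<^sub>M unit_interval"
  unfolding cube_def using assms by (intro measurable_component_singleton) auto

lemma unit_interval_borel: "f \<in> M \<rightarrow>\<^sub>M unit_interval \<Longrightarrow> f \<in> borel_measurable M"
  unfolding unit_interval_def by (simp add: measurable_restrict_space2_iff)

lemma lower_box_in_sets_cube: "{y \<in> space (cube d). \<forall>i<d. y i \<le> u i} \<in> sets (cube d)"
proof -
  have [measurable]: "(\<lambda>y. y i) \<in> borel_measurable (cube d)" if "i < d" for i
    by (rule unit_interval_borel[OF measurable_cube_component[OF that]])
  have "{y \<in> space (cube d). \<forall>i\<in>{..<d}. y i \<le> u i} \<in> sets (cube d)"
    by measurable
  then show ?thesis by (simp add: Ball_def)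
qed

lemma restrict_cube_measurable: "(\<lambda>y. restrict y {..<n}) \<in> cube (Suc n) \<rightarrow>\<^sub>M cube n"
  unfolding cube_def by (rule measurable_restrict_subset) auto

lemma cylinder_in_sets_cube:
  assumes "E \<in> sets (cube n)" "F \<in> sets unit_interval"
  shows "cylinder (Suc n) E F \<in> sets (cube (Suc n))"
proof -
  have "(\<lambda>y. restrict y {..<n}) -` E \<inter> space (cube (Suc n)) \<in> sets (cube (Suc n))"
    by (rule measurable_sets[OF restrict_cube_measurable assms(1)])
  moreover have "(\<lambda>y. y n) -` F \<inter> space (cube (Suc n)) \<in> sets (cube (Suc n))"
    by (rule measurable_sets[OF measurable_cube_component assms(2)]) simp
  moreover have "cylinder (Suc n) E F = ((\<lambda>y. restrict y {..<n}) -` E \<inter> space (cube (Suc n)))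
      \<inter> ((\<lambda>y. y n) -` F \<inter> space (cube (Suc n)))"
    by (auto simp: cylinder_def)
  ultimately show ?thesis by simp
qed

context williamson
begin

text \<open>The joint law of the first \<open>n\<close> coordinates of the simplex point and the
  reciprocal of its total.\<close>

definition joint :: "((nat \<Rightarrow> real) \<times> real) measure" where
  "joint = density (lborel_pow n \<Otimes>\<^sub>M \<gamma>) (\<lambda>w. simplex_density n (fst w) (snd w))"

definition copula_map :: "(nat \<Rightarrow> real) \<times> real \<Rightarrow> nat \<Rightarrow> real" where
  "copula_map w = (\<lambda>i\<in>{..<Suc n}. if i < n then \<psi>0 (fst w i) else residual (fst w) (snd w))"

definition law :: "(nat \<Rightarrow> real) measure" where
  "law = distr joint (cube (Suc n)) copula_map"

definition margins :: "(nat \<Rightarrow> real) \<Rightarrow> nat \<Rightarrow> real" where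
  "margins x = (\<lambda>i\<in>{..<n}. \<psi>0 (x i))"

text \<open>A measurable candidate for a left inverse of \<open>margins\<close>. The default
  \<open>0\<close> of \<open>enn2real\<close> at \<infinity> does not arise on the range of
  \<open>margins\<close>, where the pseudo-inverses are finite.\<close>

definition unmargins :: "(nat \<Rightarrow> real) \<Rightarrow> nat \<Rightarrow> real" where
  "unmargins u = (\<lambda>i\<in>{..<n}. enn2real (pseudo_inverse \<psi> (u i)))"

lemma component_measurable:
  "i < n \<Longrightarrow> (\<lambda>x. x i) \<in> borel_measurable (lborel_pow n)"
  using measurable_component_singleton[of i "{..<n}" "\<lambda>_. lborel"] by simp

lemma margins_measurable [measurable]: "margins \<in> lborel_pow n \<rightarrow>\<^sub>M cube n"
  unfolding margins_def cube_def
  by (rule measurable_restrict) (auto intro: measurable_compose[OF component_measurable psi0_measurable])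

lemma unmargins_measurable [measurable]: "unmargins \<in> cube n \<rightarrow>\<^sub>M lborel_pow n"
  unfolding unmargins_def
proof (rule measurable_restrict)
  fix i assume "i \<in> {..<n}"
  then have "(\<lambda>u. enn2real (pseudo_inverse \<psi> (u i))) \<in> borel_measurable (cube n)"
    by (auto intro: measurable_compose[OF measurable_cube_component pseudo_inverse_measurable[OF generator]])
  then show "(\<lambda>u. enn2real (pseudo_inverse \<psi> (u i))) \<in> cube n \<rightarrow>\<^sub>M lborel" by simp
qed

lemma copula_map_measurable [measurable]: "copula_map \<in> lborel_pow n \<Otimes>\<^sub>M \<gamma> \<rightarrow>\<^sub>M cube (Suc n)"
  unfolding copula_map_def cube_def
proof (rule measurable_restrict)
  fix i assume "i \<in> {..<Suc n}"
  show "(\<lambda>w. if i < n then \<psi>0 (fst w i) else residual (fst w) (snd w)) \<in> lborel_pow n \<Otimes>\<^sub>M \<gamma> \<rightarrow>\<^sub>M unit_interval"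
  proof (cases "i < n")
    case True
    have "(\<lambda>w. \<psi>0 (fst w i)) \<in> lborel_pow n \<Otimes>\<^sub>M \<gamma> \<rightarrow>\<^sub>M unit_interval"
      using measurable_compose[OF measurable_fst measurable_compose[OF component_measurable[OF True] psi0_measurable]] .
    then show ?thesis using True by simp
  next
    case False
    have "(\<lambda>w. residual (fst w) (snd w)) \<in> lborel_pow n \<Otimes>\<^sub>M \<gamma> \<rightarrow>\<^sub>M unit_interval"
      by measurable
    then show ?thesis using False by simp
  qed
qed

lemma sets_joint [simp, measurable_cong]: "sets joint = sets (lborel_pow n \<Otimes>\<^sub>M \<gamma>)"
  by (simp add: joint_def)

lemma emeasure_law:
  assumes X [measurable]: "X \<in> sets (cube (Suc n))"
  shows "emeasure law X = (\<integral>\<^sup>+x. \<integral>\<^sup>+t. simplex_density n x t * indicator X (copula_map (x, t)) \<partial>\<gamma> \<partial>lborel_pow n)"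
proof -
  let ?P = "lborel_pow n \<Otimes>\<^sub>M \<gamma>"
  have m: "copula_map -` X \<inter> space ?P \<in> sets ?P"
    by (rule measurable_sets[OF copula_map_measurable X])
  have sp: "space joint = space ?P" by (rule sets_eq_imp_space_eq[OF sets_joint])
  have "emeasure law X = emeasure joint (copula_map -` X \<inter> space ?P)"
    unfolding law_def sp[symmetric] by (rule emeasure_distr) measurable
  also have "\<dots> = (\<integral>\<^sup>+w. simplex_density n (fst w) (snd w) * indicator (copula_map -` X \<inter> space ?P) w \<partial>?P)"
    unfolding joint_def by (rule emeasure_density[OF _ m]) measurable
  also have "\<dots> = (\<integral>\<^sup>+w. simplex_density n (fst w) (snd w) * indicator X (copula_map w) \<partial>?P)"
    by (intro nn_integral_cong) (auto simp: indicator_def)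
  also have "\<dots> = (\<integral>\<^sup>+x. \<integral>\<^sup>+t. simplex_density n x t * indicator X (copula_map (x, t)) \<partial>\<gamma> \<partial>lborel_pow n)"
    by (subst nn_integral_fst[symmetric]) auto
  finally show ?thesis .
qed

lemma sets_law [simp, measurable_cong]: "sets law = sets (cube (Suc n))"
  by (simp add: law_def)

lemma space_law: "space law = space (cube (Suc n))"
  by (simp add: law_def)

lemma copula_map_in_space: "copula_map w \<in> space (cube (Suc n))"
  using psi0_range by (auto simp: copula_map_def space_cube residual_def)

lemma prob_space_law: "prob_space law"
proof (rule prob_spaceI)
  have "emeasure law (space (cube (Suc n))) = (\<integral>\<^sup>+x. fiber_mass n \<gamma> x \<partial>lborel_pow n)"
    by (subst emeasure_law) (auto simp: copula_map_in_space fiber_mass_def[abs_def])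
  also have "\<dots> = emeasure \<gamma> UNIV"
    by (rule nn_integral_fiber_mass[OF n_pos _ sets_\<gamma> AE_pos]) unfold_locales
  also have "\<dots> = 1" using emeasure_space_1 sets_eq_imp_space_eq[OF sets_\<gamma>] by simp
  finally show "emeasure law (space law) = 1" by (simp add: space_law)
qed

text \<open>This is the Galois connection in each coordinate. On the support of the density all
  arguments are non-negative, so neither the \<open>max 0\<close> in \<open>\<psi>0\<close> nor the
  truncation by \<open>ennreal\<close> interferes.\<close>

lemma lower_box_iff:
  assumes dens: "simplex_density n x t \<noteq> 0" and u: "u \<in> space (cube (Suc n))"
  shows "copula_map (x, t) \<in> {y \<in> space (cube (Suc n)). \<forall>i<Suc n. y i \<le> u i} \<longleftrightarrow>
    (\<forall>i<n. pseudo_inverse \<psi> (u i) \<le> ennreal (x i)) \<and>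
    pseudo_inverse \<psi> (u n) \<le> ennreal (1 / t - (\<Sum>i<n. x i))"
proof -
  note d = density_support[OF dens]
  have ui: "0 \<le> u i" "u i \<le> 1" if "i < Suc n" for i
    using u that by (auto simp: space_cube PiE_iff)
  have "copula_map (x, t) i \<le> u i \<longleftrightarrow> pseudo_inverse \<psi> (u i) \<le> ennreal (x i)" if "i < n" for i
    using pseudo_inverse_le_iff[OF generator ui d(4)[OF that]] d(4)[OF that] that
    by (simp add: copula_map_def \<psi>0_def)
  moreover have "copula_map (x, t) n \<le> u n \<longleftrightarrow> pseudo_inverse \<psi> (u n) \<le> ennreal (1 / t - (\<Sum>i<n. x i))"
    using pseudo_inverse_le_iff[OF generator ui d(2)] d(3) by (simp add: copula_map_def)
  ultimately show ?thesis
    using copula_map_in_space[of "(x, t)"] by (auto simp: less_Suc_eq)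
qed

text \<open>The box becomes a corner simplex whose corner consists of the pseudo-inverses.
  Integrating over \<open>x\<close> first gives the truncated power at their sum \<open>s\<close>,
  and integrating over \<open>t\<close> gives \<open>\<psi> s\<close>. An infinite pseudo-inverse
  makes the box null, in accordance with the value 0 of \<open>generator_ext \<psi>\<close> at
  \<infinity>.\<close>

lemma law_lower_box:
  assumes u: "u \<in> space (cube (Suc n))"
  shows "emeasure law {y \<in> space (cube (Suc n)). \<forall>i<Suc n. y i \<le> u i} = ennreal (archimedean (Suc n) \<psi> u)"
proof -
  define X where "X = {y \<in> space (cube (Suc n)). \<forall>i<Suc n. y i \<le> u i}"
  have X [measurable]: "X \<in> sets (cube (Suc n))" unfolding X_def by (rule lower_box_in_sets_cube)
  note iff = lower_box_iff[OF _ u, folded X_def]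
  show ?thesis unfolding X_def[symmetric]
  proof (cases "\<exists>i<Suc n. pseudo_inverse \<psi> (u i) = \<infinity>")
    case True
    then obtain j where j: "j < Suc n" "pseudo_inverse \<psi> (u j) = \<infinity>" by auto
    have zero: "simplex_density n x t * indicator X (copula_map (x, t)) = 0" for x t
    proof (cases "simplex_density n x t = 0")
      case False
      have "\<not> pseudo_inverse \<psi> (u j) \<le> ennreal r" for r using j by (simp add: top_unique)
      then have "copula_map (x, t) \<notin> X"
        unfolding iff[OF False] using j(1) less_Suc_eq by metis
      then show ?thesis by simp
    qed simp
    have "emeasure law X = 0" unfolding emeasure_law[OF X] zero by simp
    then show "emeasure law X = ennreal (archimedean (Suc n) \<psi> u)"
      using archimedean_eq_0[of j "Suc n" \<psi> u] j by simp
  next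
    case False
    define a where "a i = enn2real (pseudo_inverse \<psi> (u i))" for i
    have a: "pseudo_inverse \<psi> (u i) = ennreal (a i)" if "i < Suc n" for i
      using False that by (auto simp: a_def less_top)
    have a0: "0 \<le> a i" for i by (simp add: a_def)
    define s where "s = (\<Sum>i<Suc n. a i)"
    have s0: "0 \<le> s" unfolding s_def by (intro sum_nonneg a0)
    interpret P: pair_sigma_finite "lborel_pow n" \<gamma>
      by (rule pair_sigma_finite_lborel_pow) unfold_locales
    have "emeasure law X = (\<integral>\<^sup>+t. \<integral>\<^sup>+x. simplex_density n x t * indicator X (copula_map (x, t)) \<partial>lborel_pow n \<partial>\<gamma>)"
      unfolding emeasure_law[OF X] by (rule P.Fubini'[symmetric]) measurable
    also have "\<dots> = (\<integral>\<^sup>+t. ennreal (max 0 (1 - t * s) ^ n) \<partial>\<gamma>)"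
    proof (rule nn_integral_cong_AE, use AE_pos in eventually_elim)
      fix t :: real assume t: "0 < t"
      have "simplex_density n x t * indicator X (copula_map (x, t)) =
          simplex_density n x t * indicator {x. (\<forall>i<n. a i \<le> x i) \<and> (\<Sum>i<n. x i) \<le> 1 / t - a n} x" for x
      proof (cases "simplex_density n x t = 0")
        case False
        note d = density_support[OF False]
        have "copula_map (x, t) \<in> X \<longleftrightarrow> (\<forall>i<n. a i \<le> x i) \<and> a n \<le> 1 / t - (\<Sum>i<n. x i)"
          unfolding iff[OF False] using a d by simp
        then show ?thesis by (auto simp: indicator_def)
      qed simp
      then have "(\<integral>\<^sup>+x. simplex_density n x t * indicator X (copula_map (x, t)) \<partial>lborel_pow n)
        = (\<integral>\<^sup>+x. simplex_density n x t * indicator {x. (\<forall>i<n. a i \<le> x i) \<and> (\<Sum>i<n. x i) \<le> 1 / t - a n} x \<partial>lborel_pow n)"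
        by simp
      also have "\<dots> = ennreal (max 0 (1 - t * s) ^ n)"
        unfolding s_def sum.lessThan_Suc by (rule nn_integral_simplex_density[OF n_pos t a0 a0])
      finally show "(\<integral>\<^sup>+x. simplex_density n x t * indicator X (copula_map (x, t)) \<partial>lborel_pow n)
        = ennreal (max 0 (1 - t * s) ^ n)" .
    qed
    also have "\<dots> = ennreal (\<psi> s)"
      unfolding psi_eq[OF s0]
      by (rule nn_integral_eq_integral[OF truncated_power_integrable[OF s0]]) simp
    also have "\<psi> s = archimedean (Suc n) \<psi> u"
      unfolding s_def using a a0 by (intro archimedean_eq[symmetric]) auto
    finally show "emeasure law X = ennreal (archimedean (Suc n) \<psi> u)" .
  qed
qed

lemma has_distribution_function_eq_law:
  assumes \<mu>: "has_distribution_function (Suc n) C \<mu>"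
    and C: "\<And>x. x \<in> space (cube (Suc n)) \<Longrightarrow> C x = archimedean (Suc n) \<psi> x"
  shows "\<mu> = law"
proof (rule cube_measure_eqI[OF _ _ prob_space_law sets_law])
  note \<mu>' = \<mu>[unfolded has_distribution_function_def]
  show "prob_space \<mu>" "sets \<mu> = sets (cube (Suc n))" using \<mu>' by auto
  then interpret \<mu>: prob_space \<mu> by simp
  fix x assume x: "x \<in> space (cube (Suc n))"
  then show "emeasure \<mu> {y \<in> space (cube (Suc n)). \<forall>i<Suc n. y i \<le> x i}
      = emeasure law {y \<in> space (cube (Suc n)). \<forall>i<Suc n. y i \<le> x i}"
    using \<mu>' C by (simp add: law_lower_box \<mu>.emeasure_eq_measure)
qed simp

lemma emeasure_law_cylinder:
  assumes E: "E \<in> sets (cube n)" and F: "F \<in> sets unit_interval"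
  shows "emeasure law (cylinder (Suc n) E F)
    = (\<integral>\<^sup>+x. emeasure (fiber \<gamma> x) F * indicator E (margins x) \<partial>lborel_pow n)"
  unfolding emeasure_law[OF cylinder_in_sets_cube[OF E F]]
proof (rule nn_integral_cong)
  fix x assume x: "x \<in> space (lborel_pow n)"
  note [measurable] = E F x
  have "restrict (copula_map (x, t)) {..<n} = margins x" for t
    by (auto simp: copula_map_def margins_def restrict_def)
  moreover have "copula_map (x, t) n = residual x t" for t by (simp add: copula_map_def)
  ultimately have "indicator (cylinder (Suc n) E F) (copula_map (x, t))
      = (indicator F (residual x t) * indicator E (margins x) :: ennreal)" for t
    using copula_map_in_space[of "(x, t)"] by (auto simp: cylinder_def indicator_def)
  then have "(\<integral>\<^sup>+t. simplex_density n x t * indicator (cylinder (Suc n) E F) (copula_map (x, t)) \<partial>\<gamma>)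
      = (\<integral>\<^sup>+t. simplex_density n x t * indicator F (residual x t) * indicator E (margins x) \<partial>\<gamma>)"
    by (simp add: mult.assoc)
  also have "\<dots> = (\<integral>\<^sup>+t. simplex_density n x t * indicator F (residual x t) \<partial>\<gamma>) * indicator E (margins x)"
    by (rule nn_integral_multc) measurable
  finally show "(\<integral>\<^sup>+t. simplex_density n x t * indicator (cylinder (Suc n) E F) (copula_map (x, t)) \<partial>\<gamma>)
      = emeasure (fiber \<gamma> x) F * indicator E (margins x)"
    by (simp add: emeasure_fiber[OF sets_\<gamma> x F])
qed

section \<open>The law of the first \<open>n\<close> coordinates and its inversion\<close>

abbreviation marginal_mass :: "(nat \<Rightarrow> real) \<Rightarrow> ennreal" where
  "marginal_mass \<equiv> fiber_mass n \<gamma>"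

definition marginal :: "(nat \<Rightarrow> real) measure" where
  "marginal = distr (density (lborel_pow n) marginal_mass) (cube n) margins"

lemma marginal_mass_measurable [measurable]: "marginal_mass \<in> borel_measurable (lborel_pow n)"
  by (rule fiber_mass_measurable) (unfold_locales, rule sets_\<gamma>)

lemma nn_integral_marginal:
  assumes h [measurable]: "h \<in> borel_measurable (cube n)"
  shows "(\<integral>\<^sup>+u. h u \<partial>marginal) = (\<integral>\<^sup>+x. marginal_mass x * h (margins x) \<partial>lborel_pow n)"
proof -
  have "(\<integral>\<^sup>+u. h u \<partial>marginal) = (\<integral>\<^sup>+x. h (margins x) \<partial>density (lborel_pow n) marginal_mass)"
    unfolding marginal_def by (rule nn_integral_distr) measurable
  also have "\<dots> = (\<integral>\<^sup>+x. marginal_mass x * h (margins x) \<partial>lborel_pow n)"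
    by (rule nn_integral_density) measurable
  finally show ?thesis .
qed

lemma sets_marginal [simp, measurable_cong]: "sets marginal = sets (cube n)"
  by (simp add: marginal_def)

lemma initial_marginal_law: "initial_marginal (Suc n) law = marginal"
proof (rule measure_eqI)
  show "sets (initial_marginal (Suc n) law) = sets marginal" by (simp add: initial_marginal_def)
  fix E assume "E \<in> sets (initial_marginal (Suc n) law)"
  then have E [measurable]: "E \<in> sets (cube n)" by (simp add: initial_marginal_def)
  have F: "{0..1} \<in> sets unit_interval" by (simp add: in_sets_unit_interval)
  have r: "(\<lambda>y. restrict y {..<n}) \<in> law \<rightarrow>\<^sub>M cube n"
    using restrict_cube_measurable by (simp add: measurable_cong_sets[OF sets_law refl])
  have "emeasure (initial_marginal (Suc n) law) E = emeasure law ((\<lambda>y. restrict y {..<n}) -` E \<inter> space law)"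
    unfolding initial_marginal_def diff_Suc_1 by (rule emeasure_distr[OF r E])
  also have "(\<lambda>y. restrict y {..<n}) -` E \<inter> space law = cylinder (Suc n) E {0..1}"
  proof -
    have "y n \<in> {0..1}" if "y \<in> space (cube (Suc n))" for y
      using that unfolding space_cube by (rule PiE_mem) simp
    then show ?thesis unfolding cylinder_def space_law diff_Suc_1 by blast
  qed
  also have "emeasure law \<dots> = (\<integral>\<^sup>+x. marginal_mass x * indicator E (margins x) \<partial>lborel_pow n)"
    unfolding emeasure_law_cylinder[OF E F]
    by (intro nn_integral_cong) (simp add: emeasure_fiber_full sets_\<gamma>)
  also have "\<dots> = (\<integral>\<^sup>+u. indicator E u \<partial>marginal)"
    by (rule nn_integral_marginal[symmetric]) measurable
  finally show "emeasure (initial_marginal (Suc n) law) E = emeasure marginal E" by simp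
qed

lemma prob_space_marginal: "prob_space marginal"
proof -
  have "(\<lambda>y. restrict y {..<n}) \<in> law \<rightarrow>\<^sub>M cube n"
    using restrict_cube_measurable by (simp add: measurable_cong_sets[OF sets_law refl])
  then have "prob_space (initial_marginal (Suc n) law)"
    unfolding initial_marginal_def by (simp add: prob_space.prob_space_distr[OF prob_space_law])
  then show ?thesis by (simp add: initial_marginal_law)
qed

lemma marginal_mass_support:
  assumes "marginal_mass x \<noteq> 0"
  shows "\<exists>t. admissible t \<and> simplex_density n x t \<noteq> 0"
proof (rule ccontr)
  assume "\<not> ?thesis"
  then have "AE t in \<gamma>. simplex_density n x t = 0"
    by (intro eventually_mono[OF AE_admissible]) auto
  then have "marginal_mass x = (\<integral>\<^sup>+t. 0 \<partial>\<gamma>)"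
    unfolding fiber_mass_def by (rule nn_integral_cong_AE)
  with assms show False by simp
qed

text \<open>Positive mass provides one admissible \<open>t\<close> in the support, and
  \<open>t * x i \<le> t * (\<Sum>i<n. x i) \<le> 1\<close> places every coordinate where \<psi> can
  be inverted.\<close>

lemma unmargins_margins:
  assumes x: "x \<in> space (lborel_pow n)" and "marginal_mass x \<noteq> 0"
  shows "unmargins (margins x) = x"
proof -
  obtain t where t: "admissible t" "simplex_density n x t \<noteq> 0"
    using marginal_mass_support[OF assms(2)] by auto
  have s: "t * (\<Sum>i<n. x i) \<le> 1" "0 < t"
    using t(2) by (auto simp: simplex_density_def split: if_splits)
  note d = density_support[OF t(2)]
  have "enn2real (pseudo_inverse \<psi> (\<psi>0 (x i))) = x i" if "i < n" for i
  proof -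
    have "x i \<le> (\<Sum>i<n. x i)" using that d(4) by (intro member_le_sum) auto
    then have "t * x i \<le> t * (\<Sum>i<n. x i)" using s by simp
    then have "t * x i \<le> 1" using s(1) by (rule order_trans)
    then have "enn2real (pseudo_inverse \<psi> (\<psi> (x i))) = x i"
      using s by (intro pseudo_inverse_psi[OF t(1) d(4)[OF that]]) auto
    then show ?thesis using d(4)[OF that] by (simp add: \<psi>0_def)
  qed
  then show ?thesis
    using x by (auto simp: unmargins_def margins_def space_PiM fun_eq_iff PiE_iff extensional_def)
qed

text \<open>The mass is almost everywhere finite because its integral is that of \<gamma>. On the
  support the coordinates are non-negative, so their sum vanishes only at the origin, a null set
  since \<open>n\<close> is positive.\<close>

lemma AE_marginal_mass:
  "AE x in lborel_pow n. marginal_mass x \<noteq> 0 \<longrightarrow> marginal_mass x \<noteq> \<infinity> \<and> 0 < (\<Sum>i<n. x i) \<and> unmargins (margins x) = x"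
proof -
  let ?Z = "\<Pi>\<^sub>E i\<in>{..<n}. {0::real}"
  have "(\<integral>\<^sup>+x. marginal_mass x \<partial>lborel_pow n) = emeasure \<gamma> UNIV"
    by (rule nn_integral_fiber_mass[OF n_pos _ sets_\<gamma> AE_pos]) unfold_locales
  then have "AE x in lborel_pow n. marginal_mass x \<noteq> \<infinity>"
    using emeasure_finite[of UNIV] by (intro nn_integral_PInf_AE) auto
  moreover have "emeasure (lborel_pow n) ?Z = (\<Prod>i<n. emeasure lborel {0::real})"
    by (rule lborel_product.emeasure_PiM) auto
  then have "emeasure (lborel_pow n) ?Z = 0"
    using n_pos by (simp only: emeasure_lborel_singleton prod_constant) simp
  then have "?Z \<in> null_sets (lborel_pow n)"
    by (rule null_setsI) (rule sets_PiM_I_finite, auto)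
  then have "AE x in lborel_pow n. x \<notin> ?Z" by (rule AE_not_in)
  ultimately show ?thesis using AE_space
  proof eventually_elim
    case (elim x)
    show ?case
    proof
      assume m: "marginal_mass x \<noteq> 0"
      then obtain t where "simplex_density n x t \<noteq> 0" using marginal_mass_support by blast
      note d = density_support(4)[OF this]
      have "(\<Sum>i<n. x i) \<noteq> 0"
      proof
        assume "(\<Sum>i<n. x i) = 0"
        then have "\<forall>i\<in>{..<n}. x i = 0" using d by (subst (asm) sum_nonneg_eq_0_iff) auto
        then have "x \<in> ?Z"
          using elim(3) by (intro PiE_I) (auto simp: space_PiM intro: PiE_arb)
        with elim(2) show False by blast
      qed
      moreover have "0 \<le> (\<Sum>i<n. x i)" using d by (intro sum_nonneg) auto
      ultimately show "marginal_mass x \<noteq> \<infinity> \<and> 0 < (\<Sum>i<n. x i) \<and> unmargins (margins x) = x"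
        using elim unmargins_margins[OF elim(3) m] by simp
    qed
  qed
qed

text \<open>As \<open>marginal\<close> is the image of a measure with density
  \<open>marginal_mass\<close>, points of mass zero are invisible to it, and the premise of
  \<open>AE_marginal_mass\<close> disappears.\<close>

lemma AE_marginal:
  "AE u in marginal. 0 < (\<Sum>i<n. unmargins u i) \<and> marginal_mass (unmargins u) \<noteq> 0 \<and> marginal_mass (unmargins u) \<noteq> \<infinity>"
  (is "AE u in marginal. ?P (unmargins u)")
proof -
  have [measurable]: "(\<lambda>u. unmargins u i) \<in> borel_measurable (cube n)" if "i < n" for i
    by (rule measurable_compose[OF unmargins_measurable component_measurable[OF that]])
  have "{u \<in> space (cube n). ?P (unmargins u)} \<in> sets (cube n)"
    by measurable
  moreover have "AE x in density (lborel_pow n) marginal_mass. ?P (unmargins (margins x))"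
    unfolding AE_density[OF marginal_mass_measurable]
    using AE_marginal_mass by eventually_elim auto
  ultimately show ?thesis
    unfolding marginal_def by (subst AE_distr_iff) auto
qed

lemma emeasure_fiber_measurable:
  assumes [measurable]: "F \<in> sets unit_interval"
  shows "(\<lambda>x. emeasure (fiber \<gamma> x) F) \<in> borel_measurable (lborel_pow n)"
proof -
  have "(\<lambda>x. \<integral>\<^sup>+t. simplex_density n x t * indicator F (residual x t) \<partial>\<gamma>) \<in> borel_measurable (lborel_pow n)"
    by measurable
  then show ?thesis
    by (subst measurable_cong[OF emeasure_fiber[OF sets_\<gamma> _ assms]]) auto
qed

lemma emeasure_fiber_le:
  assumes "x \<in> space (lborel_pow n)"
  shows "emeasure (fiber \<gamma> x) F \<le> marginal_mass x"
proof -
  have "emeasure (fiber \<gamma> x) F \<le> emeasure (fiber \<gamma> x) (space (fiber \<gamma> x))" by (rule emeasure_space)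
  then show ?thesis by (simp add: emeasure_fiber_full[OF sets_\<gamma> assms])
qed

end

subsection \<open>Identification of the conditional distribution\<close>

lemma ennreal_mult_divide_cancel:
  fixes a c :: ennreal
  assumes "c \<noteq> 0" "c \<noteq> \<infinity>"
  shows "c * (a / c) = a"
  using assms by (simp add: ennreal_times_divide mult.commute[of c a] ennreal_mult_divide_eq)

context williamson
begin

text \<open>For fixed \<open>F\<close>, the kernel value \<open>emeasure (K u) F\<close> and the
  normalized fiber are both densities with respect to \<open>marginal\<close> of the measure that
  maps \<open>E\<close> to the mass of the cylinder over \<open>E\<close> and \<open>F\<close>, so
  they agree almost everywhere.\<close>

lemma conditional_distribution_fiber:
  assumes K: "K \<in> cube n \<rightarrow>\<^sub>M prob_algebra unit_interval"
    and prod: "kernel_product (Suc n) marginal K law"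
  shows "AE u in marginal. \<forall>F\<in>sets unit_interval.
    emeasure (fiber \<gamma> (unmargins u)) F = marginal_mass (unmargins u) * emeasure (K u) F"
proof -
  interpret marginal: prob_space marginal by (rule prob_space_marginal)
  have K_meas: "(\<lambda>u. emeasure (K u) F) \<in> borel_measurable (cube n)" if "F \<in> sets unit_interval" for F
    by (rule measurable_compose[OF measurable_prob_algebraD[OF K] measurable_emeasure_subprob_algebra[OF that]])
  have single: "AE u in marginal. emeasure (fiber \<gamma> (unmargins u)) F = marginal_mass (unmargins u) * emeasure (K u) F"
    if F: "F \<in> sets unit_interval" for F
  proof -
    define k where "k x = emeasure (fiber \<gamma> x) F / marginal_mass x" for x
    have [measurable]: "k \<in> borel_measurable (lborel_pow n)"
      unfolding k_def using emeasure_fiber_measurable[OF F] by measurable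
    note [measurable] = K_meas[OF F]
    have "AE u in marginal. emeasure (K u) F = k (unmargins u)"
    proof (rule marginal.density_unique_finite_measure)
      fix E assume "E \<in> sets marginal"
      then have E [measurable]: "E \<in> sets (cube n)" by simp
      have "(\<integral>\<^sup>+u. k (unmargins u) * indicator E u \<partial>marginal)
        = (\<integral>\<^sup>+x. marginal_mass x * (k (unmargins (margins x)) * indicator E (margins x)) \<partial>lborel_pow n)"
        by (rule nn_integral_marginal) measurable
      also have "\<dots> = (\<integral>\<^sup>+x. emeasure (fiber \<gamma> x) F * indicator E (margins x) \<partial>lborel_pow n)"
        using AE_marginal_mass AE_space[of "lborel_pow n"]
      proof (intro nn_integral_cong_AE, eventually_elim)
        fix x
        assume *: "marginal_mass x \<noteq> 0 \<longrightarrow> marginal_mass x \<noteq> \<infinity> \<and> 0 < (\<Sum>i<n. x i) \<and> unmargins (margins x) = x"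
          and x: "x \<in> space (lborel_pow n)"
        show "marginal_mass x * (k (unmargins (margins x)) * indicator E (margins x))
            = emeasure (fiber \<gamma> x) F * indicator E (margins x)"
        proof (cases "marginal_mass x = 0")
          case True
          then have "emeasure (fiber \<gamma> x) F = 0" using emeasure_fiber_le[OF x, of F] by simp
          then show ?thesis using True by simp
        next
          case False
          then have "marginal_mass x * k x = emeasure (fiber \<gamma> x) F"
            using * by (simp add: k_def ennreal_mult_divide_cancel)
          then show ?thesis using * False by (simp add: mult.assoc[symmetric])
        qed
      qed
      also have "\<dots> = emeasure law (cylinder (Suc n) E F)"
        by (rule emeasure_law_cylinder[OF E F, symmetric])
      also have "\<dots> = (\<integral>\<^sup>+u. emeasure (K u) F * indicator E u \<partial>marginal)"
        using prod E F by (simp add: kernel_product_def)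
      finally show "(\<integral>\<^sup>+u. emeasure (K u) F * indicator E u \<partial>marginal)
          = (\<integral>\<^sup>+u. k (unmargins u) * indicator E u \<partial>marginal)" by simp
    qed auto
    then show ?thesis
      using AE_marginal
    proof eventually_elim
      case (elim u)
      then show ?case by (simp add: k_def ennreal_mult_divide_cancel)
    qed
  qed
  \<comment> \<open>Countability makes the exceptional set independent of \<open>F\<close>; for the
    remaining \<open>u\<close>, the measures agree on a generator and are finite, hence agree on all
    Borel sets.\<close>
  have "AE u in marginal. \<forall>F\<in>rational_intervals.
      emeasure (fiber \<gamma> (unmargins u)) F = marginal_mass (unmargins u) * emeasure (K u) F"
    using single countable_rational_intervals
    by (subst AE_ball_countable) (auto simp: sets_unit_interval_eq)
  then show ?thesis using AE_marginal AE_space[of marginal]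
  proof eventually_elim
    case (elim u)
    then have u: "u \<in> space (cube n)" using sets_eq_imp_space_eq[OF sets_marginal] by simp
    then have "K u \<in> space (prob_algebra unit_interval)" by (rule measurable_space[OF K])
    then have sK: "sets (K u) = sets unit_interval" by (simp add: space_prob_algebra)
    have um: "unmargins u \<in> space (lborel_pow n)" by (rule measurable_space[OF unmargins_measurable u])
    have "fiber \<gamma> (unmargins u) = scale_measure (marginal_mass (unmargins u)) (K u)"
    proof (rule measure_eqI_generator_eq[where \<Omega>="{0..1}" and E=rational_intervals and A="\<lambda>_. {0..1}"])
      show "Int_stable rational_intervals" by (rule Int_stable_rational_intervals)
      show "rational_intervals \<subseteq> Pow {0..1}" by (rule rational_intervals_subset)
      show "sets (fiber \<gamma> (unmargins u)) = sigma_sets {0..1} rational_intervals"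
        by (simp add: sets_unit_interval_eq)
      show "sets (scale_measure (marginal_mass (unmargins u)) (K u)) = sigma_sets {0..1} rational_intervals"
        using sK by (simp add: sets_unit_interval_eq)
      show "emeasure (fiber \<gamma> (unmargins u)) {0..1} \<noteq> \<infinity>" for i :: nat
        using elim by (simp add: emeasure_fiber_full[OF sets_\<gamma> um])
      show "emeasure (fiber \<gamma> (unmargins u)) X = emeasure (scale_measure (marginal_mass (unmargins u)) (K u)) X"
        if "X \<in> rational_intervals" for X
        using elim(1) that by simp
    qed (auto simp: unit_in_rational_intervals)
    then show ?case by simp
  qed
qed

text \<open>The density \<open>marginal_mass\<close> of the marginal cancels the normalization of
  the kernel, leaving the Lebesgue integral of \<open>fiber_mass n \<beta>\<close>. The bound
  \<open>le\<close> covers the points where \<open>marginal_mass\<close> vanishes and nothing can be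
  cancelled.\<close>

lemma nn_integral_kernel_mass:
  assumes \<beta>: "finite_measure \<beta>" "sets \<beta> = sets borel" "AE t in \<beta>. 0 < t"
    and le: "\<And>x. x \<in> space (lborel_pow n) \<Longrightarrow> fiber_mass n \<beta> x \<le> marginal_mass x"
    and k: "AE u in marginal. fiber_mass n \<beta> (unmargins u) = marginal_mass (unmargins u) * k u"
  shows "(\<integral>\<^sup>+u. k u \<partial>marginal) = emeasure \<beta> UNIV"
proof -
  note [measurable] = fiber_mass_measurable[OF \<beta>(1,2)]
  \<comment> \<open>Measurability of \<open>k\<close> is not assumed, so it is first replaced almost
    everywhere by a measurable quotient.\<close>
  have "(\<integral>\<^sup>+u. k u \<partial>marginal) = (\<integral>\<^sup>+u. fiber_mass n \<beta> (unmargins u) / marginal_mass (unmargins u) \<partial>marginal)"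
    using k AE_marginal
  proof (intro nn_integral_cong_AE, eventually_elim)
    case (elim u)
    then show ?case by (simp add: mult.commute[of _ "k u"] ennreal_mult_divide_eq)
  qed
  also have "\<dots> = (\<integral>\<^sup>+x. marginal_mass x * (fiber_mass n \<beta> (unmargins (margins x)) / marginal_mass (unmargins (margins x)))
      \<partial>lborel_pow n)"
    by (rule nn_integral_marginal) measurable
  also have "\<dots> = (\<integral>\<^sup>+x. fiber_mass n \<beta> x \<partial>lborel_pow n)"
    using AE_marginal_mass AE_space[of "lborel_pow n"]
  proof (intro nn_integral_cong_AE, eventually_elim)
    fix x
    assume *: "marginal_mass x \<noteq> 0 \<longrightarrow> marginal_mass x \<noteq> \<infinity> \<and> 0 < (\<Sum>i<n. x i) \<and> unmargins (margins x) = x"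
      and x: "x \<in> space (lborel_pow n)"
    show "marginal_mass x * (fiber_mass n \<beta> (unmargins (margins x)) / marginal_mass (unmargins (margins x)))
        = fiber_mass n \<beta> x"
    proof (cases "marginal_mass x = 0")
      case True
      then show ?thesis using le[OF x] by simp
    next
      case False
      then show ?thesis
        using * by (simp add: ennreal_mult_divide_cancel)
    qed
  qed
  also have "\<dots> = emeasure \<beta> UNIV"
    by (rule nn_integral_fiber_mass[OF n_pos \<beta>])
  finally show ?thesis .
qed

lemma kernel_product_full:
  assumes "kernel_product (Suc n) marginal \<kappa> \<mu>'"
  shows "emeasure \<mu>' (space (cube (Suc n))) = (\<integral>\<^sup>+u. emeasure (\<kappa> u) {0..1} \<partial>marginal)"
proof -
  have E: "space (cube n) \<in> sets (cube n)" and F: "{0..1} \<in> sets unit_interval"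
    by (auto simp: in_sets_unit_interval)
  have "y n \<in> {0..1}" if "y \<in> space (cube (Suc n))" for y
    using that unfolding space_cube by (rule PiE_mem) simp
  moreover have "restrict y {..<n} \<in> space (cube n)" if "y \<in> space (cube (Suc n))" for y
    using measurable_space[OF restrict_cube_measurable that] .
  ultimately have "cylinder (Suc n) (space (cube n)) {0..1} = space (cube (Suc n))"
    unfolding cylinder_def diff_Suc_1 by blast
  moreover have "emeasure \<mu>' (cylinder (Suc n) (space (cube n)) {0..1})
      = (\<integral>\<^sup>+u. emeasure (\<kappa> u) {0..1} * indicator (space (cube n)) u \<partial>marginal)"
    using assms E F by (simp add: kernel_product_def)
  moreover have "\<dots> = (\<integral>\<^sup>+u. emeasure (\<kappa> u) {0..1} \<partial>marginal)"
    using sets_eq_imp_space_eq[OF sets_marginal] by (intro nn_integral_cong) simp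
  ultimately show ?thesis by simp
qed

text \<open>Almost every fiber is a multiple of \<open>K u\<close>, and the parts of \<gamma>
  decompose it. Uniqueness of the masses identifies \<open>fiber_mass\<close> of each part with the
  same multiple of the mass of the matching part of \<open>K u\<close>, and integration over the
  marginal gives the total masses.\<close>

theorem decomposition_masses:
  assumes dec: "lebesgue_decomposition \<gamma> A D S"
    and K: "K \<in> cube n \<rightarrow>\<^sub>M prob_algebra unit_interval" "kernel_product (Suc n) marginal K law"
    and decK: "\<And>u. u \<in> space (cube n) \<Longrightarrow> lebesgue_decomposition (K u) (KA u) (KD u) (KS u)"
    and prods: "kernel_product (Suc n) marginal KA \<mu>A" "kernel_product (Suc n) marginal KD \<mu>D"
      "kernel_product (Suc n) marginal KS \<mu>S"
  shows "emeasure \<mu>A (space (cube (Suc n))) = emeasure A UNIV"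
    and "emeasure \<mu>D (space (cube (Suc n))) = emeasure D UNIV"
    and "emeasure \<mu>S (space (cube (Suc n))) = emeasure S UNIV"
proof -
  have "AE u in marginal.
      fiber_mass n A (unmargins u) = marginal_mass (unmargins u) * emeasure (KA u) {0..1} \<and>
      fiber_mass n D (unmargins u) = marginal_mass (unmargins u) * emeasure (KD u) {0..1} \<and>
      fiber_mass n S (unmargins u) = marginal_mass (unmargins u) * emeasure (KS u) {0..1}"
    using conditional_distribution_fiber[OF K] AE_marginal AE_space[of marginal]
  proof eventually_elim
    case (elim u)
    then have u: "u \<in> space (cube n)" using sets_eq_imp_space_eq[OF sets_marginal] by simp
    then have "K u \<in> space (prob_algebra unit_interval)" by (rule measurable_space[OF K(1)])
    then have sK: "sets (K u) = sets unit_interval" and "prob_space (K u)"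
      by (auto simp: space_prob_algebra)
    then have fK: "finite_measure (K u)" by (simp add: prob_space.finite_measure)
    have um: "unmargins u \<in> space (lborel_pow n)" by (rule measurable_space[OF unmargins_measurable u])
    have dec_fiber: "lebesgue_decomposition (fiber \<gamma> (unmargins u)) (fiber A (unmargins u))
        (fiber D (unmargins u)) (fiber S (unmargins u))"
      using elim by (intro fiber_lebesgue_decomposition[OF dec um]) auto
    have fin: "finite_measure (fiber \<gamma> (unmargins u))"
      using elim by (intro finite_measureI) (simp add: emeasure_fiber_full[OF sets_\<gamma> um])
    have eq: "\<And>X. X \<in> sets (K u) \<Longrightarrow> emeasure (fiber \<gamma> (unmargins u)) X = marginal_mass (unmargins u) * emeasure (K u) X"
      using elim(1) sK by simp
    have "sets (fiber \<gamma> (unmargins u)) = sets (restrict_space borel {0..1})" "sets (K u) = sets (restrict_space borel {0..1})"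
      using sK by (simp_all add: unit_interval_def)
    \<comment> \<open>Here \<open>K u\<close> plays the role of \<open>M\<close>, the fiber that of
      \<open>M'\<close>, and \<open>c\<close> is \<open>marginal_mass (unmargins u)\<close>.\<close>
    from lebesgue_decomposition_mass_unique[OF decK[OF u] fK dec_fiber fin this(2,1) _ eq]
    show ?case
      by (simp add: emeasure_fiber_full[OF _ um] decomposition_sets[OF dec])
  qed
  then have k: "AE u in marginal. fiber_mass n A (unmargins u) = marginal_mass (unmargins u) * emeasure (KA u) {0..1}"
    "AE u in marginal. fiber_mass n D (unmargins u) = marginal_mass (unmargins u) * emeasure (KD u) {0..1}"
    "AE u in marginal. fiber_mass n S (unmargins u) = marginal_mass (unmargins u) * emeasure (KS u) {0..1}"
    by (auto elim: eventually_mono)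
  note fin = decomposition_finite[OF dec] and sets = decomposition_sets[OF dec]
    and pos = decomposition_AE[OF dec AE_pos] and add = fiber_mass_add[OF dec]
  show "emeasure \<mu>A (space (cube (Suc n))) = emeasure A UNIV"
    unfolding kernel_product_full[OF prods(1)]
    by (rule nn_integral_kernel_mass[OF fin(1) sets(1) pos(1) _ k(1)]) (simp add: add add.assoc)
  show "emeasure \<mu>D (space (cube (Suc n))) = emeasure D UNIV"
    unfolding kernel_product_full[OF prods(2)]
    by (rule nn_integral_kernel_mass[OF fin(2) sets(2) pos(2) _ k(2)]) (simp add: add add_increasing add_increasing2)
  show "emeasure \<mu>S (space (cube (Suc n))) = emeasure S UNIV"
    unfolding kernel_product_full[OF prods(3)]
    by (rule nn_integral_kernel_mass[OF fin(3) sets(3) pos(3) _ k(3)]) (simp add: add add_increasing)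
qed

end

theorem theorem3p12:
  fixes d :: nat
    and C :: "(nat \<Rightarrow> real) \<Rightarrow> real"
    and \<gamma> \<gamma>abs \<gamma>dis \<gamma>sing :: "real measure"
    and \<mu> \<mu>abs \<mu>dis \<mu>sing :: "(nat \<Rightarrow> real) measure"
    and K Kabs Kdis Ksing :: "(nat \<Rightarrow> real) \<Rightarrow> real measure"
  assumes "2 \<le> d"
    and "C \<in> archimedean_copulas d"
    and "williamson_measure_of d C \<gamma>"
    and "lebesgue_decomposition \<gamma> \<gamma>abs \<gamma>dis \<gamma>sing"
    and "has_distribution_function d C \<mu>"
    and "conditional_distribution d \<mu> K"
    and "\<forall>x\<in>space (cube (d - 1)). lebesgue_decomposition (K x) (Kabs x) (Kdis x) (Ksing x)"
    and "kernel_product d (initial_marginal d \<mu>) Kabs \<mu>abs"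
    and "kernel_product d (initial_marginal d \<mu>) Kdis \<mu>dis"
    and "kernel_product d (initial_marginal d \<mu>) Ksing \<mu>sing"
  shows "(emeasure \<gamma>dis {0..} > 0 \<longleftrightarrow> emeasure \<mu>dis (space (cube d)) > 0) \<and>
         (emeasure \<gamma>abs {0..} > 0 \<longleftrightarrow> emeasure \<mu>abs (space (cube d)) > 0) \<and>
         (emeasure \<gamma>sing {0..} > 0 \<longleftrightarrow> emeasure \<mu>sing (space (cube d)) > 0)"
proof -
  obtain n where d: "d = Suc n" and n: "1 \<le> n"
    using assms(1) by (cases d) auto
  \<comment> \<open>The same measure, regarded on the whole line as the locale requires.\<close>
  let ?b = "\<lambda>\<beta>::real measure. distr \<beta> borel (\<lambda>x. x)"
  obtain \<psi> where gen: "normalized_generator \<psi>"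
    and \<psi>: "\<And>z. 0 \<le> z \<Longrightarrow> \<psi> z = williamson_transform d \<gamma> z"
    and C: "\<And>x. x \<in> space (cube d) \<Longrightarrow> C x = archimedean d \<psi> x"
    using assms(3) by (auto simp: williamson_measure_of_def)
  have prob: "prob_space \<gamma>" and sets: "sets \<gamma> = sets (restrict_space borel {0..})" and zero: "emeasure \<gamma> {0} = 0"
    using assms(3) by (auto simp: williamson_measure_of_def williamson_probs_def)
  have sp: "space \<gamma> = {0..}" using sets_eq_imp_space_eq[OF sets] by (simp add: space_restrict_space)
  have id: "(\<lambda>x. x) \<in> \<gamma> \<rightarrow>\<^sub>M borel"
    unfolding measurable_cong_sets[OF sets refl] by (rule measurable_restrict_space1) simp
  interpret williamson n \<psi> "?b \<gamma>"
  proof (rule williamson.intro)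
    show "prob_space (?b \<gamma>)" by (rule prob_space.prob_space_distr[OF prob id])
    have "{0} \<in> null_sets \<gamma>" using zero sets by (auto simp: null_sets_def sets_restrict_space_iff)
    then have "AE t in \<gamma>. t \<notin> {0}" by (rule AE_not_in)
    then have "AE t in \<gamma>. 0 < t" using AE_space by eventually_elim (auto simp: sp)
    then show "AE t in ?b \<gamma>. 0 < t" by (subst AE_distr_iff[OF id]) auto
    show "\<psi> z = williamson_transform (Suc n) (?b \<gamma>) z" if "0 \<le> z" for z
      using \<psi>[OF that] unfolding d williamson_transform_def
      by (subst integral_distr[OF id]) auto
  qed (use n gen in auto)
  have \<mu>: "\<mu> = law"
    by (rule has_distribution_function_eq_law[OF assms(5)[unfolded d]]) (use C d in auto)
  have im: "initial_marginal d \<mu> = marginal" unfolding \<mu> d by (rule initial_marginal_law)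
  have dec: "lebesgue_decomposition (?b \<gamma>) (?b \<gamma>abs) (?b \<gamma>dis) (?b \<gamma>sing)"
    by (rule lebesgue_decomposition_distr_borel[OF assms(4) sets]) simp
  have K: "K \<in> cube n \<rightarrow>\<^sub>M prob_algebra unit_interval" "kernel_product (Suc n) marginal K law"
    using assms(6) unfolding conditional_distribution_def im by (simp_all add: d \<mu>)
  have decK: "\<And>u. u \<in> space (cube n) \<Longrightarrow> lebesgue_decomposition (K u) (Kabs u) (Kdis u) (Ksing u)"
    using assms(7) by (simp add: d)
  \<comment> \<open>Corresponding masses are equal, so they are positive simultaneously; it remains
    to replace \<open>UNIV\<close> by the carrier \<open>{0..}\<close>.\<close>
  note masses = decomposition_masses[OF dec K decK assms(8-10)[unfolded im, unfolded d]]
  have "emeasure (?b \<beta>) UNIV = emeasure \<beta> {0..}" if "sets \<beta> = sets \<gamma>" for \<beta>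
    using that sets by (subst emeasure_distr_restricted_borel) auto
  then show ?thesis
    using masses assms(4) by (simp add: d lebesgue_decomposition_def)
qed

end
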